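(* Let $H$ be a Hopf algebra over a field $k$ and let $A$ be a (right) $H$-comodule algebra. Let $\mathrm{Quot}_{gen}(H)$ be the complete lattice of quotients $H/I$ of $H$ by coideal right ideals $I$, and let $\mathrm{Sub}_{alg}(A/A^{co\,H})$ be the complete lattice of all subalgebras of $A$ containing $A^{co\,H}$, ordered by inclusion. Then there exists a Galois connection between these complete lattices, $$\phi:\mathrm{Quot}_{gen}(H)\to \mathrm{Sub}_{alg}(A/A^{co\,H}),\qquad \psi:\mathrm{Sub}_{alg}(A/A^{co\,H})\to \mathrm{Quot}_{gen}(H),$$ in which $\phi(Q)=A^{co\,Q}$ for every $Q\in\mathrm{Quot}_{gen}(H)$.
   Context: Algebras are associative and unital. A (right) $H$-comodule algebra is an algebra $A$ with a coassociative and counital coaction $\delta:A\to A\otimes H$ which is an algebra map; $A^{co\,H}=\{a\in A:\delta(a)=a\otimes 1\}$. $\mathrm{Quot}_{gen}(H)=\{H/I: I \text{ is a coideal and a right ideal of } H\}$, ordered by $H/I\succeq H/J$ iff $I\subseteq J$. For $Q=H/I$ with quotient map $\pi:H\to Q$, $A^{co\,Q}=\{a\in A:(\mathrm{id}\otimes\pi)\delta(a)=a\otimes\pi(1)\}$, i.e. those $a$ with $\delta(a)-a\otimes 1\in A\otimes I$; it is a subalgebra of $A$ containing $A^{co\,H}$. A Galois connection between posets $P$ and $R$ is a pair of order-reversing maps $\phi:P\to R$, $\psi:R\to P$ with $p\le\psi\phi(p)$ for all $p\in P$ and $r\le\phi\psi(r)$ for all $r\in R$. *)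

theory Defs
  imports Complex_Main "HOL-Library.Poly_Mapping" "HOL-Algebra.Complete_Lattice"
begin

section \<open>Tensor products over a field\<close>

text \<open>
  The scalars are a type \<open>'k::field\<close>.  Vector spaces are kept with an explicit carrier, because
  quotients \<open>H/I\<close> and tensor products are sets of equivalence classes which have no type of their
  own (their type would have to depend on \<open>I\<close>, respectively on the scalar multiplications).
\<close>

record ('k, 'v) vspace = "'v partial_object" +
  vadd :: "'v \<Rightarrow> 'v \<Rightarrow> 'v"
  vscale :: "'k \<Rightarrow> 'v \<Rightarrow> 'v"

definition type_space :: "('k \<Rightarrow> 'v \<Rightarrow> 'v) \<Rightarrow> ('k, 'v::ab_group_add) vspace" where
  "type_space s = \<lparr>carrier = UNIV, vadd = (+), vscale = s\<rparr>"

text \<open>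
  \<open>'x \<Rightarrow>\<^sub>0 'k\<close> is the free vector space on \<open>'x\<close>; its scalar multiplication, and the linear extension
  of a map defined on the basis.
\<close>

definition free_scale :: "'k::field \<Rightarrow> ('x \<Rightarrow>\<^sub>0 'k) \<Rightarrow> ('x \<Rightarrow>\<^sub>0 'k)" where
  "free_scale c = Poly_Mapping.map ((*) c)"

definition free_ext :: "('x \<Rightarrow> ('y \<Rightarrow>\<^sub>0 'k::field)) \<Rightarrow> ('x \<Rightarrow>\<^sub>0 'k) \<Rightarrow> ('y \<Rightarrow>\<^sub>0 'k)" where
  "free_ext f x = (\<Sum>p\<in>Poly_Mapping.keys x. free_scale (Poly_Mapping.lookup x p) (f p))"

definition tensor_relators ::
  "('k::field, 'v) vspace \<Rightarrow> ('k, 'w) vspace \<Rightarrow> (('v \<times> 'w) \<Rightarrow>\<^sub>0 'k) set" where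
  "tensor_relators V W =
     {Poly_Mapping.single (vadd V v v', w) 1 - Poly_Mapping.single (v, w) 1
        - Poly_Mapping.single (v', w) 1 | v v' w.
        v \<in> carrier V \<and> v' \<in> carrier V \<and> w \<in> carrier W} \<union>
     {Poly_Mapping.single (v, vadd W w w') 1 - Poly_Mapping.single (v, w) 1
        - Poly_Mapping.single (v, w') 1 | v w w'.
        v \<in> carrier V \<and> w \<in> carrier W \<and> w' \<in> carrier W} \<union>
     {Poly_Mapping.single (vscale V c v, w) 1 - free_scale c (Poly_Mapping.single (v, w) 1) | c v w.
        v \<in> carrier V \<and> w \<in> carrier W} \<union>
     {Poly_Mapping.single (v, vscale W c w) 1 - free_scale c (Poly_Mapping.single (v, w) 1) | c v w.
        v \<in> carrier V \<and> w \<in> carrier W}"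

definition formal_tensors ::
  "('k::field, 'v) vspace \<Rightarrow> ('k, 'w) vspace \<Rightarrow> (('v \<times> 'w) \<Rightarrow>\<^sub>0 'k) set" where
  "formal_tensors V W = {x. Poly_Mapping.keys x \<subseteq> carrier V \<times> carrier W}"

definition tensor_eq ::
  "('k::field, 'v) vspace \<Rightarrow> ('k, 'w) vspace \<Rightarrow> (('v \<times> 'w) \<Rightarrow>\<^sub>0 'k) rel" where
  "tensor_eq V W =
     {(x, y). x \<in> formal_tensors V W \<and> y \<in> formal_tensors V W \<and>
              x - y \<in> module.span free_scale (tensor_relators V W)}"

abbreviation tensor_class ::
  "('k::field, 'v) vspace \<Rightarrow> ('k, 'w) vspace \<Rightarrow> (('v \<times> 'w) \<Rightarrow>\<^sub>0 'k) \<Rightarrow> (('v \<times> 'w) \<Rightarrow>\<^sub>0 'k) set" where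
  "tensor_class V W x \<equiv> tensor_eq V W `` {x}"

text \<open>
  Operations on classes are written, as usual for quotients, as unions over representatives of the
  resulting classes; by well-definedness all the sets in such a union coincide.
\<close>

definition tensor ::
  "('k::field, 'v) vspace \<Rightarrow> ('k, 'w) vspace \<Rightarrow> ('k, (('v \<times> 'w) \<Rightarrow>\<^sub>0 'k) set) vspace"
  (infixr \<open>\<otimes>\<^sub>v\<close> 70) where
  "V \<otimes>\<^sub>v W =
     \<lparr>carrier = formal_tensors V W // tensor_eq V W,
      vadd = (\<lambda>X Y. \<Union>x\<in>X. \<Union>y\<in>Y. tensor_class V W (x + y)),
      vscale = (\<lambda>c X. \<Union>x\<in>X. tensor_class V W (free_scale c x))\<rparr>"

definition pure_tensor ::
  "('k::field, 'v) vspace \<Rightarrow> ('k, 'w) vspace \<Rightarrow> 'v \<Rightarrow> 'w \<Rightarrow> (('v \<times> 'w) \<Rightarrow>\<^sub>0 'k) set" where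
  "pure_tensor V W v w = tensor_class V W (Poly_Mapping.single (v, w) 1)"

text \<open>The map \<open>f \<otimes> g\<close> into \<open>V' \<otimes>\<^sub>v W'\<close>, for linear \<open>f\<close> and \<open>g\<close>.\<close>

definition tensor_map ::
  "('k::field, 'v') vspace \<Rightarrow> ('k, 'w') vspace \<Rightarrow> ('v \<Rightarrow> 'v') \<Rightarrow> ('w \<Rightarrow> 'w') \<Rightarrow>
     (('v \<times> 'w) \<Rightarrow>\<^sub>0 'k) set \<Rightarrow> (('v' \<times> 'w') \<Rightarrow>\<^sub>0 'k) set" where
  "tensor_map V' W' f g X =
     (\<Union>x\<in>X. tensor_class V' W' (free_ext (\<lambda>(v, w). Poly_Mapping.single (f v, g w) 1) x))"

text \<open>
  The linear map on a tensor product induced by a bilinear map \<open>f\<close> into a vector space given by a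
  type with scalar multiplication \<open>s\<close>; the image below is a singleton.
\<close>

definition tensor_lift ::
  "('k::field \<Rightarrow> 'u \<Rightarrow> 'u) \<Rightarrow> ('v \<Rightarrow> 'w \<Rightarrow> 'u) \<Rightarrow> (('v \<times> 'w) \<Rightarrow>\<^sub>0 'k) set \<Rightarrow> 'u::ab_group_add" where
  "tensor_lift s f X =
     the_elem ((\<lambda>x. \<Sum>(v, w)\<in>Poly_Mapping.keys x. s (Poly_Mapping.lookup x (v, w)) (f v w)) ` X)"

text \<open>
  The canonical isomorphism from \<open>(V \<otimes>\<^sub>v W) \<otimes>\<^sub>v U\<close> to \<open>V \<otimes>\<^sub>v (W \<otimes>\<^sub>v U)\<close>, sending
  \<open>(v \<otimes> w) \<otimes> u\<close> to \<open>v \<otimes> (w \<otimes> u)\<close>.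
\<close>

definition tensor_assoc ::
  "('k::field, 'v) vspace \<Rightarrow> ('k, 'w) vspace \<Rightarrow> ('k, 'u) vspace \<Rightarrow>
     (((('v \<times> 'w) \<Rightarrow>\<^sub>0 'k) set \<times> 'u) \<Rightarrow>\<^sub>0 'k) set \<Rightarrow> (('v \<times> (('w \<times> 'u) \<Rightarrow>\<^sub>0 'k) set) \<Rightarrow>\<^sub>0 'k) set" where
  "tensor_assoc V W U Z =
     (\<Union>z\<in>Z. tensor_class V (W \<otimes>\<^sub>v U)
        (free_ext (\<lambda>(X, u).
           free_ext (\<lambda>(v, w). Poly_Mapping.single (v, pure_tensor W U w u) 1) (SOME x. x \<in> X)) z))"

text \<open>The product \<open>(v \<otimes> w) (v' \<otimes> w') = v v' \<otimes> w w'\<close> of the tensor product of two algebras.\<close>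

definition tensor_mult ::
  "('k::field, 'v::times) vspace \<Rightarrow> ('k, 'w::times) vspace \<Rightarrow>
     (('v \<times> 'w) \<Rightarrow>\<^sub>0 'k) set \<Rightarrow> (('v \<times> 'w) \<Rightarrow>\<^sub>0 'k) set \<Rightarrow> (('v \<times> 'w) \<Rightarrow>\<^sub>0 'k) set" where
  "tensor_mult V W X Y =
     (\<Union>x\<in>X. \<Union>y\<in>Y. tensor_class V W
        (free_ext (\<lambda>(v, w). free_ext (\<lambda>(v', w'). Poly_Mapping.single (v * v', w * w') 1) y) x))"

definition linear_into ::
  "('k \<Rightarrow> 'v \<Rightarrow> 'v) \<Rightarrow> ('k, 't) vspace \<Rightarrow> ('v::ab_group_add \<Rightarrow> 't) \<Rightarrow> bool" where
  "linear_into s T f \<longleftrightarrow>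
     (\<forall>v. f v \<in> carrier T) \<and>
     (\<forall>v w. f (v + w) = vadd T (f v) (f w)) \<and>
     (\<forall>c v. f (s c v) = vscale T c (f v))"


section \<open>Hopf algebras and comodule algebras\<close>

text \<open>
  The sort \<open>{ring, monoid_mult}\<close> is that of unital rings without the axiom \<open>0 \<noteq> 1\<close> of \<open>ring_1\<close>, so
  that the zero algebra is not excluded.
\<close>

locale unital_algebra = vector_space scale
  for scale :: "'k::field \<Rightarrow> 'a::{ring, monoid_mult} \<Rightarrow> 'a" +
  assumes scale_mult_left: "scale c x * y = scale c (x * y)"
    and scale_mult_right: "x * scale c y = scale c (x * y)"

definition algebra_map_into_tensor ::
  "('k::field \<Rightarrow> 'c \<Rightarrow> 'c) \<Rightarrow> ('k \<Rightarrow> 'a \<Rightarrow> 'a) \<Rightarrow> ('k \<Rightarrow> 'b \<Rightarrow> 'b) \<Rightarrow>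
     ('c::{ring, monoid_mult} \<Rightarrow> (('a::{ring, monoid_mult} \<times> 'b::{ring, monoid_mult}) \<Rightarrow>\<^sub>0 'k) set) \<Rightarrow> bool"
  where
  "algebra_map_into_tensor sC sA sB f \<longleftrightarrow>
     linear_into sC (type_space sA \<otimes>\<^sub>v type_space sB) f \<and>
     (\<forall>x y. f (x * y) = tensor_mult (type_space sA) (type_space sB) (f x) (f y)) \<and>
     f 1 = pure_tensor (type_space sA) (type_space sB) 1 1"

locale coalgebra = vector_space scale
  for scale :: "'k::field \<Rightarrow> 'h::ab_group_add \<Rightarrow> 'h" +
  fixes \<Delta> :: "'h \<Rightarrow> (('h \<times> 'h) \<Rightarrow>\<^sub>0 'k) set"
    and \<epsilon> :: "'h \<Rightarrow> 'k"
  assumes comult_linear: "linear_into scale (type_space scale \<otimes>\<^sub>v type_space scale) \<Delta>"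
    and counit_linear: "Vector_Spaces.linear scale (*) \<epsilon>"
    and coassoc:
      "tensor_assoc (type_space scale) (type_space scale) (type_space scale)
         (tensor_map (type_space scale \<otimes>\<^sub>v type_space scale) (type_space scale) \<Delta> id (\<Delta> h))
       = tensor_map (type_space scale) (type_space scale \<otimes>\<^sub>v type_space scale) id \<Delta> (\<Delta> h)"
    and counit_left: "tensor_lift scale (\<lambda>x y. scale (\<epsilon> x) y) (\<Delta> h) = h"
    and counit_right: "tensor_lift scale (\<lambda>x y. scale (\<epsilon> y) x) (\<Delta> h) = h"

locale bialgebra = unital_algebra scale + coalgebra scale \<Delta> \<epsilon>
  for scale :: "'k::field \<Rightarrow> 'h::{ring, monoid_mult} \<Rightarrow> 'h"
    and \<Delta> :: "'h \<Rightarrow> (('h \<times> 'h) \<Rightarrow>\<^sub>0 'k) set"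
    and \<epsilon> :: "'h \<Rightarrow> 'k" +
  assumes comult_algebra_map: "algebra_map_into_tensor scale scale scale \<Delta>"
    and counit_mult: "\<epsilon> (x * y) = \<epsilon> x * \<epsilon> y"
    and counit_one: "\<epsilon> 1 = 1"

locale hopf_algebra = bialgebra scale \<Delta> \<epsilon>
  for scale :: "'k::field \<Rightarrow> 'h::{ring, monoid_mult} \<Rightarrow> 'h"
    and \<Delta> :: "'h \<Rightarrow> (('h \<times> 'h) \<Rightarrow>\<^sub>0 'k) set"
    and \<epsilon> :: "'h \<Rightarrow> 'k" +
  fixes S :: "'h \<Rightarrow> 'h"
  assumes antipode_linear: "Vector_Spaces.linear scale scale S"
    and antipode_left: "tensor_lift scale (\<lambda>x y. S x * y) (\<Delta> h) = scale (\<epsilon> h) 1"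
    and antipode_right: "tensor_lift scale (\<lambda>x y. x * S y) (\<Delta> h) = scale (\<epsilon> h) 1"

locale right_comodule_algebra =
  H: bialgebra scaleH \<Delta> \<epsilon> + A: unital_algebra scaleA
  for scaleH :: "'k::field \<Rightarrow> 'h::{ring, monoid_mult} \<Rightarrow> 'h"
    and \<Delta> :: "'h \<Rightarrow> (('h \<times> 'h) \<Rightarrow>\<^sub>0 'k) set"
    and \<epsilon> :: "'h \<Rightarrow> 'k"
    and scaleA :: "'k \<Rightarrow> 'a::{ring, monoid_mult} \<Rightarrow> 'a" +
  fixes \<delta> :: "'a \<Rightarrow> (('a \<times> 'h) \<Rightarrow>\<^sub>0 'k) set"
  assumes coaction_algebra_map: "algebra_map_into_tensor scaleA scaleA scaleH \<delta>"
    and coaction_coassoc: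
      "tensor_assoc (type_space scaleA) (type_space scaleH) (type_space scaleH)
         (tensor_map (type_space scaleA \<otimes>\<^sub>v type_space scaleH) (type_space scaleH) \<delta> id (\<delta> a))
       = tensor_map (type_space scaleA) (type_space scaleH \<otimes>\<^sub>v type_space scaleH) id \<Delta> (\<delta> a)"
    and coaction_counit: "tensor_lift scaleA (\<lambda>x h. scaleA (\<epsilon> h) x) (\<delta> a) = a"


section \<open>Quotients by coideal right ideals\<close>

text \<open>
  The subspace \<open>I \<otimes> H + H \<otimes> I\<close> of \<open>H \<otimes> H\<close>: its elements are the sums of tensors \<open>x \<otimes> y\<close> with
  \<open>x \<in> I\<close> or \<open>y \<in> I\<close>.
\<close>

definition coideal_tensors ::
  "('k::field \<Rightarrow> 'h \<Rightarrow> 'h) \<Rightarrow> 'h set \<Rightarrow> (('h::ab_group_add \<times> 'h) \<Rightarrow>\<^sub>0 'k) set set" where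
  "coideal_tensors scale I =
     {tensor_class (type_space scale) (type_space scale) x | x.
        Poly_Mapping.keys x \<subseteq> I \<times> UNIV \<union> UNIV \<times> I}"

definition coideal ::
  "('k::field \<Rightarrow> 'h::ab_group_add \<Rightarrow> 'h) \<Rightarrow> ('h \<Rightarrow> (('h \<times> 'h) \<Rightarrow>\<^sub>0 'k) set) \<Rightarrow> ('h \<Rightarrow> 'k) \<Rightarrow>
     'h set \<Rightarrow> bool" where
  "coideal scale \<Delta> \<epsilon> I \<longleftrightarrow>
     module.subspace scale I \<and> (\<forall>h\<in>I. \<Delta> h \<in> coideal_tensors scale I) \<and> (\<forall>h\<in>I. \<epsilon> h = 0)"

definition right_ideal ::
  "('k::field \<Rightarrow> 'h::{ring, monoid_mult} \<Rightarrow> 'h) \<Rightarrow> 'h set \<Rightarrow> bool" where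
  "right_ideal scale I \<longleftrightarrow> module.subspace scale I \<and> (\<forall>x\<in>I. \<forall>h. x * h \<in> I)"

definition quotient_by :: "'h::ab_group_add set \<Rightarrow> 'h set set" where
  "quotient_by I = UNIV // {(x, y). x - y \<in> I}"

definition quotient_map :: "'h set set \<Rightarrow> 'h \<Rightarrow> 'h set" where
  "quotient_map Q h = (THE X. X \<in> Q \<and> h \<in> X)"

definition quotient_space ::
  "('k::field \<Rightarrow> 'h \<Rightarrow> 'h) \<Rightarrow> 'h::ab_group_add set set \<Rightarrow> ('k, 'h set) vspace" where
  "quotient_space scale Q =
     \<lparr>carrier = Q,
      vadd = (\<lambda>X Y. THE Z. Z \<in> Q \<and> (\<forall>x\<in>X. \<forall>y\<in>Y. x + y \<in> Z)),
      vscale = (\<lambda>c X. THE Z. Z \<in> Q \<and> (\<forall>x\<in>X. scale c x \<in> Z))\<rparr>"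

text \<open>
  The order on quotients: \<open>H/J \<preceq> H/I\<close> iff \<open>I \<subseteq> J\<close>.
\<close>

definition Quot_gen ::
  "('k::field \<Rightarrow> 'h::{ring, monoid_mult} \<Rightarrow> 'h) \<Rightarrow> ('h \<Rightarrow> (('h \<times> 'h) \<Rightarrow>\<^sub>0 'k) set) \<Rightarrow> ('h \<Rightarrow> 'k) \<Rightarrow>
     'h set set gorder" where
  "Quot_gen scale \<Delta> \<epsilon> =
     \<lparr>carrier = {quotient_by I | I. coideal scale \<Delta> \<epsilon> I \<and> right_ideal scale I},
      eq = (=),
      le = (\<lambda>R Q. \<exists>I J. coideal scale \<Delta> \<epsilon> I \<and> right_ideal scale I \<and>
                        coideal scale \<Delta> \<epsilon> J \<and> right_ideal scale J \<and>
                        Q = quotient_by I \<and> R = quotient_by J \<and> I \<subseteq> J)\<rparr>"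


section \<open>Coinvariants and subalgebras\<close>

definition coinvariants_H ::
  "('k::field \<Rightarrow> 'h::{ring, monoid_mult} \<Rightarrow> 'h) \<Rightarrow> ('k \<Rightarrow> 'a::{ring, monoid_mult} \<Rightarrow> 'a) \<Rightarrow>
     ('a \<Rightarrow> (('a \<times> 'h) \<Rightarrow>\<^sub>0 'k) set) \<Rightarrow> 'a set" where
  "coinvariants_H scaleH scaleA \<delta> =
     {a. \<delta> a = pure_tensor (type_space scaleA) (type_space scaleH) a 1}"

text \<open>The equation \<open>(id \<otimes> \<pi>) (\<delta> a) = a \<otimes> \<pi> 1\<close> takes place in \<open>A \<otimes> Q\<close>.\<close>

definition coinvariants ::
  "('k::field \<Rightarrow> 'h::{ring, monoid_mult} \<Rightarrow> 'h) \<Rightarrow> ('k \<Rightarrow> 'a::{ring, monoid_mult} \<Rightarrow> 'a) \<Rightarrow>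
     ('a \<Rightarrow> (('a \<times> 'h) \<Rightarrow>\<^sub>0 'k) set) \<Rightarrow> 'h set set \<Rightarrow> 'a set" where
  "coinvariants scaleH scaleA \<delta> Q =
     {a. tensor_map (type_space scaleA) (quotient_space scaleH Q) id (quotient_map Q) (\<delta> a)
         = pure_tensor (type_space scaleA) (quotient_space scaleH Q) a (quotient_map Q 1)}"

definition is_subalgebra ::
  "('k::field \<Rightarrow> 'a::{ring, monoid_mult} \<Rightarrow> 'a) \<Rightarrow> 'a set \<Rightarrow> bool" where
  "is_subalgebra scale B \<longleftrightarrow>
     module.subspace scale B \<and> 1 \<in> B \<and> (\<forall>x\<in>B. \<forall>y\<in>B. x * y \<in> B)"

definition Sub_alg ::
  "('k::field \<Rightarrow> 'a::{ring, monoid_mult} \<Rightarrow> 'a) \<Rightarrow> 'a set \<Rightarrow> 'a set gorder" where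
  "Sub_alg scale C =
     \<lparr>carrier = {B. is_subalgebra scale B \<and> C \<subseteq> B}, eq = (=), le = (\<subseteq>)\<rparr>"


section \<open>Galois connections\<close>

text \<open>
  Antitone (order-reversing) Galois connections; the locale \<open>galois_connection\<close> of HOL-Algebra
  is the monotone one.
\<close>

definition antitone_galois_connection ::
  "('p, 'x) gorder_scheme \<Rightarrow> ('r, 'y) gorder_scheme \<Rightarrow> ('p \<Rightarrow> 'r) \<Rightarrow> ('r \<Rightarrow> 'p) \<Rightarrow> bool" where
  "antitone_galois_connection P R \<phi> \<psi> \<longleftrightarrow>
     \<phi> \<in> carrier P \<rightarrow> carrier R \<and> \<psi> \<in> carrier R \<rightarrow> carrier P \<and>
     (\<forall>p\<in>carrier P. \<forall>q\<in>carrier P. p \<sqsubseteq>\<^bsub>P\<^esub> q \<longrightarrow> \<phi> q \<sqsubseteq>\<^bsub>R\<^esub> \<phi> p) \<and>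
     (\<forall>r\<in>carrier R. \<forall>s\<in>carrier R. r \<sqsubseteq>\<^bsub>R\<^esub> s \<longrightarrow> \<psi> s \<sqsubseteq>\<^bsub>P\<^esub> \<psi> r) \<and>
     (\<forall>p\<in>carrier P. p \<sqsubseteq>\<^bsub>P\<^esub> \<psi> (\<phi> p)) \<and>
     (\<forall>r\<in>carrier R. r \<sqsubseteq>\<^bsub>R\<^esub> \<phi> (\<psi> r))"

end

theory Submission
  imports Defs
begin

text \<open>
  Coinvariance is a condition on linear forms.  Over a field a tensor is zero as soon as all product
  forms \<open>f \<otimes> k\<close> vanish on it, so \<open>a\<close> lies in \<open>A\<^sup>c\<^sup>o\<^sup>Q\<close>, with \<open>Q = H/I\<close>, iff
  \<open>(f \<otimes> k) (\<delta> a) = f a * k 1\<close> for every linear form \<open>f\<close> on \<open>A\<close> and every linear form \<open>k\<close> on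
  \<open>H\<close> that annihilates \<open>I\<close> (\<open>mem_coinvariants_iff\<close>).  Equivalently, every \<^emph>\<open>coinvariance defect\<close>
  \<open>(f \<otimes> id) (\<delta> a) - f a 1\<close> lies in \<open>I\<close>.

  This shows what the adjoint must be.  Given a set \<open>B\<close>, the right ideal \<open>coideal_of B\<close> generated
  by the defects of all \<open>b \<in> B\<close> is the smallest right ideal \<open>J\<close> with
  \<open>B \<subseteq> A\<^sup>c\<^sup>o\<^sup>H\<^sup>/\<^sup>J\<close> (\<open>coideal_of_subset_iff\<close>), and the Galois connection is
  \<open>\<phi> (H/I) = A\<^sup>c\<^sup>o\<^sup>H\<^sup>/\<^sup>I\<close>, \<open>\<psi> B = H/coideal_of B\<close>, provided that \<open>coideal_of B\<close> is a coideal.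

  That is the heart of the proof (\<open>comult_defect\<close>, \<open>coideal_of_is_coideal\<close>).  For a defect
  \<open>v = (f \<otimes> id) (\<delta> b) - f b 1\<close> and forms \<open>g\<close>, \<open>k\<close> that vanish on all defects, coassociativity of
  \<open>\<delta>\<close> turns \<open>(g \<otimes> k) (\<Delta> v)\<close> into \<open>(f' \<otimes> k) (\<delta> b) - f b * g 1 * k 1\<close> with
  \<open>f' = (f \<otimes> g) \<circ> \<delta>\<close>; the vanishing of \<open>k\<close> on defects gives \<open>f' b * k 1 - f b * g 1 * k 1\<close>, and that
  of \<open>g\<close> gives \<open>0\<close>.  Multiplicativity of \<open>\<Delta>\<close> carries this over to the right ideal generated by the
  defects, and counitality of \<open>\<delta>\<close> shows that \<open>\<epsilon>\<close> vanishes there.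

  Both posets are complete because they have all infima: intersections of subalgebras on one side,
  and on the other the quotient by the sum of a family of coideal right ideals, which is again a
  coideal right ideal.

  The passage to linear forms starts from the presentation of tensors as classes of formal sums.  Two
  formal sums are equivalent iff all bilinear forms agree on them
  (\<open>tensor_eq_iff_bilinear_forms\<close>).  Expanding one factor in a basis writes a bilinear form, on
  any given formal sum, as a finite sum of product forms (\<open>zero_if_product_forms_zero\<close>).  From then on
  the structure maps are only ever evaluated on forms, and any representative of a class will do.
\<close>


section \<open>Linear forms on vector spaces\<close>

text \<open>
  Linear forms relative to a carrier, since the forms on \<open>A \<otimes>\<^sub>v H\<close> and on \<open>H/I\<close> are needed as well as
  those on a type.
\<close>

definition linear_form :: "('k::field, 'v) vspace \<Rightarrow> ('v \<Rightarrow> 'k) \<Rightarrow> bool" where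
  "linear_form V f \<longleftrightarrow>
     (\<forall>x\<in>carrier V. \<forall>y\<in>carrier V. f (vadd V x y) = f x + f y) \<and>
     (\<forall>c. \<forall>x\<in>carrier V. f (vscale V c x) = c * f x)"

lemma type_space_simps [simp]:
  "carrier (type_space s) = UNIV" "vadd (type_space s) = (+)" "vscale (type_space s) = s"
  by (simp_all add: type_space_def)

lemma linear_form_type_space:
  "linear_form (type_space s) f \<longleftrightarrow> (\<forall>x y. f (x + y) = f x + f y) \<and> (\<forall>c x. f (s c x) = c * f x)"
  by (simp add: linear_form_def)

lemma linear_form_0: "linear_form (type_space s) f \<Longrightarrow> f 0 = (0::'k::field)"
  unfolding linear_form_type_space by (metis add_0 add_left_imp_eq add_0_right)

lemma linear_form_add: "linear_form (type_space s) f \<Longrightarrow> f (x + y) = f x + f y"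
  and linear_form_scale: "linear_form (type_space s) f \<Longrightarrow> f (s c x) = c * f x"
  by (simp_all add: linear_form_type_space)

lemma linear_form_diff: "linear_form (type_space s) f \<Longrightarrow> f (x - y) = f x - f y"
  using linear_form_add[of s f "x - y" y] by simp

lemma linear_form_sum: "linear_form (type_space s) f \<Longrightarrow> f (sum g S) = (\<Sum>i\<in>S. f (g i))"
  by (induction S rule: infinite_finite_induct) (auto simp: linear_form_0 linear_form_add)

text \<open>
  Extending a basis of a subspace \<open>U\<close> to the whole space gives coordinates in which each basis
  vector either lies in \<open>U\<close> or has a coordinate form that vanishes on \<open>U\<close>.
\<close>

lemma (in vector_space) obtain_adapted_coordinates:
  assumes "subspace U"
  obtains c where "\<And>b. linear_form (type_space scale) (\<lambda>v. c v b)"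
    and "\<And>v. finite {b. c v b \<noteq> 0}"
    and "\<And>v. (\<Sum>b | c v b \<noteq> 0. scale (c v b) b) = v"
    and "\<And>b. b \<in> U \<or> (\<forall>v\<in>U. c v b = 0)"
proof -
  obtain B0 where B0: "B0 \<subseteq> U" "independent B0" "U \<subseteq> span B0"
    by (rule maximal_independent_subset[of U])
  obtain B where B: "B0 \<subseteq> B" "independent B" "UNIV \<subseteq> span B"
    using maximal_independent_subset_extend[OF subset_UNIV B0(2)] by metis
  have B': "v \<in> span B" for v
    using B(3) by auto
  have "b \<in> U \<or> (\<forall>v\<in>U. representation B v b = 0)" for b
  proof (cases "b \<in> B0")
    case False
    have "representation B v b = 0" if "v \<in> U" for v
    proof -
      have "representation B v = representation B0 v"
        using representation_extend[OF B(2) _ B(1)] that B0(3) by blast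
      thus ?thesis
        using False representation_ne_zero[of B0 v b] by auto
    qed
    thus ?thesis by blast
  qed (use B0 in blast)
  moreover have "linear_form (type_space scale) (\<lambda>v. representation B v b)" for b
    by (simp add: linear_form_type_space representation_add representation_scale B B')
  ultimately show ?thesis
    using that[of "representation B"]
    by (simp add: finite_representation sum_nonzero_representation_eq B B')
qed

text \<open>
  A vector outside \<open>U\<close> has a nonzero coordinate at some basis vector outside \<open>U\<close>, and that
  coordinate form annihilates \<open>U\<close>.
\<close>

lemma (in vector_space) mem_subspace_if_annihilated:
  assumes "subspace U"
    and "\<And>f. linear_form (type_space scale) f \<Longrightarrow> \<forall>u\<in>U. f u = 0 \<Longrightarrow> f v = 0"
  shows "v \<in> U"
proof -
  obtain c where c: "\<And>b. linear_form (type_space scale) (\<lambda>v. c v b)"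
      "\<And>v. (\<Sum>b | c v b \<noteq> 0. scale (c v b) b) = v" "\<And>b. b \<in> U \<or> (\<forall>v\<in>U. c v b = 0)"
    by (rule obtain_adapted_coordinates[OF assms(1)]) blast
  have "b \<in> U" if "c v b \<noteq> 0" for b
    using c(3)[of b] assms(2)[OF c(1)[of b]] that by blast
  hence "(\<Sum>b | c v b \<noteq> 0. scale (c v b) b) \<in> U"
    by (intro subspace_sum assms(1) subspace_scale) auto
  thus ?thesis by (simp add: c)
qed

lemma (in vector_space) linear_form_zero_on_span:
  assumes "linear_form (type_space scale) f" "\<And>x. x \<in> X \<Longrightarrow> f x = 0" "x \<in> span X"
  shows "f x = 0"
  using assms(3)
  by (induction rule: span_induct_alt)
    (simp_all add: linear_form_0[OF assms(1)] linear_form_add[OF assms(1)]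
      linear_form_scale[OF assms(1)] assms(2))

lemma (in vector_space) eq_if_forms_eq:
  assumes "\<And>f. linear_form (type_space scale) f \<Longrightarrow> f v = f w"
  shows "v = w"
proof -
  have "v - w \<in> {0}"
    by (rule mem_subspace_if_annihilated) (auto simp: linear_form_diff dest: assms)
  thus ?thesis by simp
qed


section \<open>The free vector space\<close>

definition free_form :: "('x \<Rightarrow> 'k) \<Rightarrow> ('x \<Rightarrow>\<^sub>0 'k::field) \<Rightarrow> 'k" where
  "free_form \<beta> x = (\<Sum>p\<in>Poly_Mapping.keys x. Poly_Mapping.lookup x p * \<beta> p)"

lemma lookup_free_scale: "Poly_Mapping.lookup (free_scale c x) p = c * Poly_Mapping.lookup x p"
  by (simp add: free_scale_def map.rep_eq when_def)

interpretation free: vector_space free_scale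
  by unfold_locales
    (auto intro!: poly_mapping_eqI simp: lookup_free_scale lookup_add algebra_simps)

lemma free_form_superset:
  "finite S \<Longrightarrow> Poly_Mapping.keys x \<subseteq> S \<Longrightarrow> free_form \<beta> x = (\<Sum>p\<in>S. Poly_Mapping.lookup x p * \<beta> p)"
  unfolding free_form_def by (rule sum.mono_neutral_left) (auto simp: in_keys_iff)

lemma free_form_add [simp]: "free_form \<beta> (x + y) = free_form \<beta> x + free_form \<beta> y"
proof -
  let ?S = "Poly_Mapping.keys x \<union> Poly_Mapping.keys y"
  have "Poly_Mapping.keys (x + y) \<subseteq> ?S" by (rule keys_add)
  thus ?thesis
    by (simp add: free_form_superset[of ?S] lookup_add algebra_simps sum.distrib)
qed

lemma free_form_scale [simp]: "free_form \<beta> (free_scale c x) = c * free_form \<beta> x"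
  by (subst free_form_superset[of "Poly_Mapping.keys x"])
    (auto simp: in_keys_iff lookup_free_scale free_form_def sum_distrib_left mult.assoc)

lemma free_form_single [simp]: "free_form \<beta> (Poly_Mapping.single p c) = c * \<beta> p"
  by (simp add: free_form_def)

lemma linear_form_free_form: "linear_form (type_space free_scale) (free_form \<beta>)"
  by (simp add: linear_form_type_space)

lemmas free_form_0 [simp] = linear_form_0[OF linear_form_free_form]
  and free_form_diff [simp] = linear_form_diff[OF linear_form_free_form]
  and free_form_sum = linear_form_sum[OF linear_form_free_form]

lemma free_basis_expansion:
  "x = (\<Sum>p\<in>Poly_Mapping.keys x. free_scale (Poly_Mapping.lookup x p) (Poly_Mapping.single p 1))"
proof (rule poly_mapping_eqI)
  fix q
  show "Poly_Mapping.lookup x q = Poly_Mapping.lookup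
     (\<Sum>p\<in>Poly_Mapping.keys x. free_scale (Poly_Mapping.lookup x p) (Poly_Mapping.single p 1)) q"
    by (cases "q \<in> Poly_Mapping.keys x")
      (auto simp: lookup_sum lookup_free_scale lookup_single when_def in_keys_iff
        if_distrib[of "\<lambda>t. _ * t"] cong: if_cong)
qed

lemma linear_form_free_eq:
  assumes "linear_form (type_space free_scale) f"
  shows "f x = free_form (\<lambda>p. f (Poly_Mapping.single p 1)) x"
  by (subst free_basis_expansion)
    (simp add: linear_form_sum[OF assms] linear_form_scale[OF assms] free_form_def)

lemma free_form_free_ext: "free_form \<beta> (free_ext F x) = free_form (\<lambda>p. free_form \<beta> (F p)) x"
  by (simp add: free_ext_def free_form_sum) (simp add: free_form_def)

lemma free_form_cong:
  "(\<And>p. p \<in> Poly_Mapping.keys x \<Longrightarrow> \<beta> p = \<gamma> p) \<Longrightarrow> free_form \<beta> x = free_form \<gamma> x"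
  by (simp add: free_form_def)

lemma free_form_mult_left: "free_form (\<lambda>p. c * \<beta> p) x = c * free_form \<beta> x"
  by (simp add: free_form_def sum_distrib_left algebra_simps)

lemma free_form_swap:
  "free_form (\<lambda>p. free_form (\<lambda>q. \<beta> p q) y) x = free_form (\<lambda>q. free_form (\<lambda>p. \<beta> p q) x) y"
  unfolding free_form_def sum_distrib_left
  by (subst sum.swap) (simp add: mult.left_commute)

lemma keys_free_ext: "Poly_Mapping.keys (free_ext F x) \<subseteq> (\<Union>p\<in>Poly_Mapping.keys x. Poly_Mapping.keys (F p))"
proof
  fix q assume "q \<in> Poly_Mapping.keys (free_ext F x)"
  hence "(\<Sum>p\<in>Poly_Mapping.keys x. Poly_Mapping.lookup x p * Poly_Mapping.lookup (F p) q) \<noteq> 0"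
    by (simp add: free_ext_def in_keys_iff lookup_sum lookup_free_scale)
  then obtain p where "p \<in> Poly_Mapping.keys x" "Poly_Mapping.lookup x p * Poly_Mapping.lookup (F p) q \<noteq> 0"
    by (meson sum.neutral)
  thus "q \<in> (\<Union>p\<in>Poly_Mapping.keys x. Poly_Mapping.keys (F p))"
    by (auto simp: in_keys_iff)
qed

text \<open>
  The span of \<open>R\<close> is the intersection of the kernels of the linear forms that vanish on \<open>R\<close>, and a
  linear form on the free vector space is an arbitrary function on the basis.
\<close>

lemma mem_span_iff_free_forms:
  "x \<in> free.span R \<longleftrightarrow> (\<forall>\<beta>. (\<forall>r\<in>R. free_form \<beta> r = 0) \<longrightarrow> free_form \<beta> x = 0)"
proof
  assume "x \<in> free.span R"
  thus "\<forall>\<beta>. (\<forall>r\<in>R. free_form \<beta> r = 0) \<longrightarrow> free_form \<beta> x = 0"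
    by (induction rule: free.span_induct_alt) auto
next
  assume *: "\<forall>\<beta>. (\<forall>r\<in>R. free_form \<beta> r = 0) \<longrightarrow> free_form \<beta> x = 0"
  show "x \<in> free.span R"
  proof (rule free.mem_subspace_if_annihilated)
    fix f assume f: "linear_form (type_space free_scale) f" "\<forall>u\<in>free.span R. f u = (0::'b)"
    define \<beta> where "\<beta> = (\<lambda>p. f (Poly_Mapping.single p 1))"
    have f_eq: "f y = free_form \<beta> y" for y
      unfolding \<beta>_def by (rule linear_form_free_eq[OF f(1)])
    have "\<forall>r\<in>R. free_form \<beta> r = 0"
      using f(2) free.span_base[of _ R] by (simp add: f_eq)
    with * show "f x = 0" by (simp add: f_eq)
  qed simp
qed


section \<open>Tensors and bilinear forms\<close>

definition bilinear_form ::
  "('k::field, 'v) vspace \<Rightarrow> ('k, 'w) vspace \<Rightarrow> ('v \<times> 'w \<Rightarrow> 'k) \<Rightarrow> bool" where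
  "bilinear_form V W \<beta> \<longleftrightarrow>
     (\<forall>w\<in>carrier W. linear_form V (\<lambda>v. \<beta> (v, w))) \<and>
     (\<forall>v\<in>carrier V. linear_form W (\<lambda>w. \<beta> (v, w)))"

text \<open>
  That the extension of \<open>\<beta>\<close> vanishes on the four families of relators is additivity and homogeneity
  of \<open>\<beta>\<close> in each argument.
\<close>

lemma bilinear_form_iff_relators:
  "bilinear_form V W \<beta> \<longleftrightarrow> (\<forall>r\<in>tensor_relators V W. free_form \<beta> r = 0)"
proof
  assume *: "\<forall>r\<in>tensor_relators V W. free_form \<beta> r = 0"
  have rel: "free_form \<beta> r = 0" if "r \<in> tensor_relators V W" for r
    using * that by blast
  show "bilinear_form V W \<beta>"
    unfolding bilinear_form_def linear_form_def
  proof (intro conjI ballI allI)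
    fix w v v' assume "w \<in> carrier W" "v \<in> carrier V" "v' \<in> carrier V"
    hence "Poly_Mapping.single (vadd V v v', w) 1 - Poly_Mapping.single (v, w) 1
        - Poly_Mapping.single (v', w) 1 \<in> tensor_relators V W"
      unfolding tensor_relators_def by blast
    from rel[OF this] show "\<beta> (vadd V v v', w) = \<beta> (v, w) + \<beta> (v', w)"
      by (simp add: diff_diff_eq)
  next
    fix w v c assume "w \<in> carrier W" "v \<in> carrier V"
    hence "Poly_Mapping.single (vscale V c v, w) 1 - free_scale c (Poly_Mapping.single (v, w) 1)
        \<in> tensor_relators V W"
      unfolding tensor_relators_def by blast
    from rel[OF this] show "\<beta> (vscale V c v, w) = c * \<beta> (v, w)"
      by simp
  next
    fix v w w' assume "v \<in> carrier V" "w \<in> carrier W" "w' \<in> carrier W"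
    hence "Poly_Mapping.single (v, vadd W w w') 1 - Poly_Mapping.single (v, w) 1
        - Poly_Mapping.single (v, w') 1 \<in> tensor_relators V W"
      unfolding tensor_relators_def by blast
    from rel[OF this] show "\<beta> (v, vadd W w w') = \<beta> (v, w) + \<beta> (v, w')"
      by (simp add: diff_diff_eq)
  next
    fix v w c assume "v \<in> carrier V" "w \<in> carrier W"
    hence "Poly_Mapping.single (v, vscale W c w) 1 - free_scale c (Poly_Mapping.single (v, w) 1)
        \<in> tensor_relators V W"
      unfolding tensor_relators_def by blast
    from rel[OF this] show "\<beta> (v, vscale W c w) = c * \<beta> (v, w)"
      by simp
  qed
qed (auto simp: tensor_relators_def bilinear_form_def linear_form_def)

text \<open>
  The universal property of the tensor product in scalar form; it replaces the span of the
  relators in all later arguments.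
\<close>

lemma tensor_eq_iff_bilinear_forms:
  "(x, y) \<in> tensor_eq V W \<longleftrightarrow> x \<in> formal_tensors V W \<and> y \<in> formal_tensors V W \<and>
     (\<forall>\<beta>. bilinear_form V W \<beta> \<longrightarrow> free_form \<beta> x = free_form \<beta> y)"
  by (auto simp: tensor_eq_def mem_span_iff_free_forms bilinear_form_iff_relators)

lemma formal_tensors_type_space [simp]: "formal_tensors (type_space s) (type_space t) = UNIV"
  by (simp add: formal_tensors_def)

lemma equiv_tensor_eq: "equiv (formal_tensors V W) (tensor_eq V W)"
  unfolding equiv_def by (auto simp: refl_on_def sym_def trans_def tensor_eq_iff_bilinear_forms)

text \<open>
  If \<open>c v b\<close> are coordinates on the first factor, then \<open>\<beta> (v, w) = \<Sum>b. c v b * \<beta> (b, w)\<close>, and the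
  sum is finite on the support of \<open>x\<close>.  So product forms suffice to recognise the zero tensor.
\<close>

lemma zero_if_product_forms_zero:
  assumes c: "\<And>v. finite {b. c v b \<noteq> 0}" "\<And>v. (\<Sum>b | c v b \<noteq> 0. s (c v b) b) = v"
    and \<beta>: "bilinear_form (type_space s) W \<beta>"
    and x: "x \<in> formal_tensors (type_space s) W"
    and zero: "\<And>b. free_form (\<lambda>(v, w). c v b * \<beta> (b, w)) x = 0"
  shows "free_form \<beta> x = 0"
proof -
  define S where "S = (\<Union>p\<in>Poly_Mapping.keys x. {b. c (fst p) b \<noteq> 0})"
  have S: "finite S" unfolding S_def using c(1) by auto
  have "\<beta> p = (\<Sum>b\<in>S. c (fst p) b * \<beta> (b, snd p))" if p: "p \<in> Poly_Mapping.keys x" for p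
  proof -
    have lin: "linear_form (type_space s) (\<lambda>v. \<beta> (v, snd p))"
      using \<beta> x p by (auto simp: bilinear_form_def formal_tensors_def)
    have "\<beta> p = \<beta> (\<Sum>b | c (fst p) b \<noteq> 0. s (c (fst p) b) b, snd p)"
      by (simp add: c)
    also have "\<dots> = (\<Sum>b | c (fst p) b \<noteq> 0. c (fst p) b * \<beta> (b, snd p))"
      by (simp add: linear_form_sum[OF lin] linear_form_scale[OF lin])
    also have "\<dots> = (\<Sum>b\<in>S. c (fst p) b * \<beta> (b, snd p))"
      by (rule sum.mono_neutral_left[OF S]) (use p in \<open>auto simp: S_def\<close>)
    finally show ?thesis .
  qed
  hence "free_form \<beta> x = free_form (\<lambda>p. \<Sum>b\<in>S. c (fst p) b * \<beta> (b, snd p)) x"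
    by (rule free_form_cong)
  also have "\<dots> = (\<Sum>b\<in>S. free_form (\<lambda>(v, w). c v b * \<beta> (b, w)) x)"
    unfolding free_form_def by (subst sum.swap) (simp add: sum_distrib_left split_beta)
  finally show ?thesis by (simp add: zero)
qed

definition product_form :: "('v \<Rightarrow> 'k::field) \<Rightarrow> ('w \<Rightarrow> 'k) \<Rightarrow> 'v \<times> 'w \<Rightarrow> 'k" where
  "product_form f g p = f (fst p) * g (snd p)"

lemma product_form_pair [simp]: "product_form f g (v, w) = f v * g w"
  by (simp add: product_form_def)

lemma bilinear_product_form:
  "linear_form V f \<Longrightarrow> linear_form W g \<Longrightarrow> bilinear_form V W (product_form f g)"
  by (simp add: bilinear_form_def linear_form_def algebra_simps)

text \<open>
  The form \<open>f \<otimes> g\<close> on \<open>V \<otimes>\<^sub>v W\<close>, evaluated at an arbitrary representative; for linear \<open>f\<close> and \<open>g\<close>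
  the choice does not matter (\<open>tensor_form_eq\<close>).
\<close>

definition tensor_form :: "('v \<Rightarrow> 'k::field) \<Rightarrow> ('w \<Rightarrow> 'k) \<Rightarrow> (('v \<times> 'w) \<Rightarrow>\<^sub>0 'k) set \<Rightarrow> 'k" where
  "tensor_form f g X = free_form (product_form f g) (SOME x. x \<in> X)"

lemma tensor_form_eq:
  assumes "linear_form V f" "linear_form W g" "X \<in> carrier (V \<otimes>\<^sub>v W)" "x \<in> X"
  shows "tensor_form f g X = free_form (product_form f g) x"
proof -
  have "(SOME x. x \<in> X) \<in> X" using assms(4) by (rule someI)
  moreover have "X \<in> formal_tensors V W // tensor_eq V W"
    using assms(3) by (simp add: tensor_def)
  ultimately have "(SOME x. x \<in> X, x) \<in> tensor_eq V W"
    using assms(4) equiv_tensor_eq by (metis quotient_eq_iff)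
  thus ?thesis
    unfolding tensor_form_def tensor_eq_iff_bilinear_forms
    using bilinear_product_form[OF assms(1,2)] by blast
qed

lemma tensor_carrier_nonempty:
  assumes "X \<in> carrier (V \<otimes>\<^sub>v W)"
  obtains x where "x \<in> X" "x \<in> formal_tensors V W"
proof -
  have "X \<in> formal_tensors V W // tensor_eq V W" using assms by (simp add: tensor_def)
  thus ?thesis
    using that equiv_tensor_eq
    by (metis equals0I in_quotient_imp_non_empty in_quotient_imp_subset subsetD)
qed

lemma tensor_class_carrier: "x \<in> formal_tensors V W \<Longrightarrow> tensor_class V W x \<in> carrier (V \<otimes>\<^sub>v W)"
  by (simp add: tensor_def quotientI)

lemma tensor_carrier_class:
  assumes "X \<in> carrier (V \<otimes>\<^sub>v W)" "x \<in> X"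
  shows "X = tensor_class V W x"
proof -
  obtain y where y: "y \<in> formal_tensors V W" "X = tensor_class V W y"
    using assms(1) by (auto simp: tensor_def elim: quotientE)
  with assms(2) equiv_tensor_eq show ?thesis by (metis Image_singleton_iff equiv_class_eq)
qed

lemma tensor_form_class:
  assumes "linear_form V f" "linear_form W g" "x \<in> formal_tensors V W"
  shows "tensor_form f g (tensor_class V W x) = free_form (product_form f g) x"
  by (rule tensor_form_eq[OF assms(1,2) tensor_class_carrier])
    (use assms(3) in \<open>auto simp: tensor_eq_iff_bilinear_forms\<close>)

lemma tensor_form_pure:
  assumes "linear_form V f" "linear_form W g" "v \<in> carrier V" "w \<in> carrier W"
  shows "tensor_form f g (pure_tensor V W v w) = f v * g w"
  unfolding pure_tensor_def using assms
  by (subst tensor_form_class) (auto simp: formal_tensors_def)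

lemma formal_tensors_add: "x \<in> formal_tensors V W \<Longrightarrow> y \<in> formal_tensors V W \<Longrightarrow> x + y \<in> formal_tensors V W"
  using keys_add by (fastforce simp: formal_tensors_def)

lemma formal_tensors_scale: "x \<in> formal_tensors V W \<Longrightarrow> free_scale c x \<in> formal_tensors V W"
  by (auto simp: formal_tensors_def in_keys_iff lookup_free_scale)

lemma linear_form_tensor_form:
  assumes f: "linear_form V f" and g: "linear_form W g"
  shows "linear_form (V \<otimes>\<^sub>v W) (tensor_form f g)"
  unfolding linear_form_def
proof (intro conjI ballI allI)
  \<comment> \<open>A sum of classes is a union over representatives, so the form is evaluated at whatever
    element \<open>z\<close> of that union has been chosen, without first proving that the union is one class.\<close>
  fix X Y assume XY: "X \<in> carrier (V \<otimes>\<^sub>v W)" "Y \<in> carrier (V \<otimes>\<^sub>v W)"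
  have val: "free_form (product_form f g) z = tensor_form f g X + tensor_form f g Y"
    if "z \<in> vadd (V \<otimes>\<^sub>v W) X Y" for z
  proof -
    from that obtain x y where xy: "x \<in> X" "y \<in> Y" "(x + y, z) \<in> tensor_eq V W"
      by (auto simp: tensor_def)
    thus ?thesis
      using bilinear_product_form[OF f g] tensor_form_eq[OF f g XY(1) xy(1)]
        tensor_form_eq[OF f g XY(2) xy(2)]
      by (auto simp: tensor_eq_iff_bilinear_forms)
  qed
  obtain x where x: "x \<in> X" "x \<in> formal_tensors V W" using XY tensor_carrier_nonempty by metis
  obtain y where y: "y \<in> Y" "y \<in> formal_tensors V W" using XY tensor_carrier_nonempty by metis
  have "x + y \<in> vadd (V \<otimes>\<^sub>v W) X Y"
    using x y formal_tensors_add[OF x(2) y(2)] by (force simp: tensor_def tensor_eq_iff_bilinear_forms)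
  hence "(SOME z. z \<in> vadd (V \<otimes>\<^sub>v W) X Y) \<in> vadd (V \<otimes>\<^sub>v W) X Y" by (rule someI)
  from val[OF this] show "tensor_form f g (vadd (V \<otimes>\<^sub>v W) X Y) = tensor_form f g X + tensor_form f g Y"
    by (simp add: tensor_form_def)
next
  fix c X assume X: "X \<in> carrier (V \<otimes>\<^sub>v W)"
  have val: "free_form (product_form f g) z = c * tensor_form f g X"
    if "z \<in> vscale (V \<otimes>\<^sub>v W) c X" for z
  proof -
    from that obtain x where x: "x \<in> X" "(free_scale c x, z) \<in> tensor_eq V W"
      by (auto simp: tensor_def)
    thus ?thesis
      using bilinear_product_form[OF f g] tensor_form_eq[OF f g X x(1)]
      by (auto simp: tensor_eq_iff_bilinear_forms)
  qed
  obtain x where x: "x \<in> X" "x \<in> formal_tensors V W" using X tensor_carrier_nonempty by metis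
  have "free_scale c x \<in> vscale (V \<otimes>\<^sub>v W) c X"
    using x formal_tensors_scale[OF x(2)] by (force simp: tensor_def tensor_eq_iff_bilinear_forms)
  hence "(SOME z. z \<in> vscale (V \<otimes>\<^sub>v W) c X) \<in> vscale (V \<otimes>\<^sub>v W) c X" by (rule someI)
  from val[OF this] show "tensor_form f g (vscale (V \<otimes>\<^sub>v W) c X) = c * tensor_form f g X"
    by (simp add: tensor_form_def)
qed


section \<open>Tensors modulo subspaces\<close>

definition annihilator :: "('k::field \<Rightarrow> 'v \<Rightarrow> 'v) \<Rightarrow> 'v::ab_group_add set \<Rightarrow> ('v \<Rightarrow> 'k) set" where
  "annihilator s U = {f. linear_form (type_space s) f \<and> (\<forall>u\<in>U. f u = 0)}"

lemma annihilator_antimono: "U \<subseteq> U' \<Longrightarrow> annihilator s U' \<subseteq> annihilator s U"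
  by (auto simp: annihilator_def)

text \<open>
  The subspace \<open>I \<otimes> H + H \<otimes> I\<close> is the common kernel of the forms \<open>f \<otimes> g\<close> with \<open>f\<close>, \<open>g\<close> annihilating
  \<open>I\<close>.  In one direction, a bilinear form that vanishes on \<open>I \<times> H\<close> and \<open>H \<times> I\<close> is expanded in
  coordinates adapted to \<open>I\<close>: the terms for basis vectors in \<open>I\<close> vanish, and all others are product
  forms of annihilators of \<open>I\<close>.
\<close>

lemma coideal_tensors_iff_forms:
  assumes s: "vector_space s" and I: "module.subspace s I"
    and X: "X \<in> carrier (type_space s \<otimes>\<^sub>v type_space s)"
  shows "X \<in> coideal_tensors s I \<longleftrightarrow>
    (\<forall>f\<in>annihilator s I. \<forall>g\<in>annihilator s I. tensor_form f g X = 0)"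
proof
  assume "X \<in> coideal_tensors s I"
  then obtain x where x: "X = tensor_class (type_space s) (type_space s) x"
      "Poly_Mapping.keys x \<subseteq> I \<times> UNIV \<union> UNIV \<times> I"
    by (auto simp: coideal_tensors_def)
  show "\<forall>f\<in>annihilator s I. \<forall>g\<in>annihilator s I. tensor_form f g X = 0"
  proof (intro ballI)
    fix f g assume fg: "f \<in> annihilator s I" "g \<in> annihilator s I"
    hence "product_form f g p = 0" if "p \<in> Poly_Mapping.keys x" for p
      using that x(2) by (auto simp: annihilator_def product_form_def)
    hence "free_form (product_form f g) x = 0" by (simp add: free_form_def)
    thus "tensor_form f g X = 0"
      using fg by (simp add: x(1) tensor_form_class annihilator_def)
  qed
next
  assume zero: "\<forall>f\<in>annihilator s I. \<forall>g\<in>annihilator s I. tensor_form f g X = 0"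
  let ?H = "type_space s"
  define K where "K = I \<times> UNIV \<union> UNIV \<times> I"
  define P where "P = (\<lambda>p. Poly_Mapping.single p (1::'a)) ` K"
  obtain c where c: "\<And>b. linear_form ?H (\<lambda>v. c v b)" "\<And>v. finite {b. c v b \<noteq> 0}"
      "\<And>v. (\<Sum>b | c v b \<noteq> 0. s (c v b) b) = v" "\<And>b. b \<in> I \<or> (\<forall>v\<in>I. c v b = 0)"
    by (rule vector_space.obtain_adapted_coordinates[OF s I]) blast
  obtain x where x: "x \<in> X" using X tensor_carrier_nonempty by metis
  \<comment> \<open>Modulo the relators, \<open>x\<close> is a combination of the generators \<open>P\<close> of \<open>I \<otimes> H + H \<otimes> I\<close>.\<close>
  have "x \<in> free.span (tensor_relators ?H ?H \<union> P)"
    unfolding mem_span_iff_free_forms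
  proof (intro allI impI)
    fix \<beta> assume "\<forall>r\<in>tensor_relators ?H ?H \<union> P. free_form \<beta> r = 0"
    hence \<beta>: "bilinear_form ?H ?H \<beta>" and "\<forall>r\<in>P. free_form \<beta> r = 0"
      by (auto simp: bilinear_form_iff_relators)
    hence "free_form \<beta> (Poly_Mapping.single p 1) = 0" if "p \<in> K" for p
      using that unfolding P_def by blast
    hence \<beta>0: "\<beta> p = 0" if "p \<in> K" for p
      using that by simp
    have "free_form (\<lambda>(v, w). c v b * \<beta> (b, w)) x = 0" for b
    proof (cases "b \<in> I")
      case True
      thus ?thesis by (simp add: \<beta>0 K_def free_form_def case_prod_unfold)
    next
      case False
      hence "(\<lambda>v. c v b) \<in> annihilator s I" using c(1,4) by (auto simp: annihilator_def)
      moreover have "(\<lambda>w. \<beta> (b, w)) \<in> annihilator s I"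
        using \<beta> by (auto simp: annihilator_def bilinear_form_def K_def intro: \<beta>0)
      ultimately have "tensor_form (\<lambda>v. c v b) (\<lambda>w. \<beta> (b, w)) X = 0"
          and lin: "linear_form ?H (\<lambda>w. \<beta> (b, w))"
        using zero by (blast, simp add: annihilator_def)
      thus ?thesis
        using tensor_form_eq[OF c(1) lin X x]
        by (simp add: product_form_def[abs_def] case_prod_unfold)
    qed
    thus "free_form \<beta> x = 0"
      using zero_if_product_forms_zero[OF c(2,3) \<beta>] by simp
  qed
  then obtain r y where ry: "x = r + y" "r \<in> free.span (tensor_relators ?H ?H)" "y \<in> free.span P"
    unfolding free.span_Un by blast
  have "Poly_Mapping.keys y \<subseteq> K"
    using ry(3)
  proof (induction rule: free.span_induct_alt)
    case (step c r y)
    then obtain p where p: "p \<in> K" "r = Poly_Mapping.single p 1" unfolding P_def by blast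
    have "Poly_Mapping.keys (free_scale c r) \<subseteq> {p}"
      by (auto simp: p(2) in_keys_iff lookup_free_scale lookup_single when_def split: if_splits)
    thus ?case
      using keys_add[of "free_scale c r" y] step p(1) by blast
  qed simp
  moreover have "(x, y) \<in> tensor_eq ?H ?H"
    using ry by (simp add: tensor_eq_def)
  hence "X = tensor_class ?H ?H y"
    using tensor_carrier_class[OF X x] equiv_class_eq[OF equiv_tensor_eq] by blast
  ultimately show "X \<in> coideal_tensors s I"
    unfolding coideal_tensors_def K_def by blast
qed

lemma coideal_iff_forms:
  assumes s: "vector_space s" and \<Delta>: "linear_into s (type_space s \<otimes>\<^sub>v type_space s) \<Delta>"
  shows "coideal s \<Delta> \<epsilon> I \<longleftrightarrow> module.subspace s I \<and> (\<forall>h\<in>I. \<epsilon> h = 0) \<and>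
    (\<forall>h\<in>I. \<forall>f\<in>annihilator s I. \<forall>g\<in>annihilator s I. tensor_form f g (\<Delta> h) = 0)"
  using coideal_tensors_iff_forms[OF s] \<Delta> by (auto simp: coideal_def linear_into_def)

definition coset_of :: "'h::ab_group_add set \<Rightarrow> 'h \<Rightarrow> 'h set" where
  "coset_of I h = {y. h - y \<in> I}"

lemma quotient_by_eq: "quotient_by I = range (coset_of I)"
  by (auto simp: quotient_by_def quotient_def coset_of_def)

context vector_space
begin

lemma coset_of_eq_iff:
  assumes "subspace I"
  shows "coset_of I h = coset_of I h' \<longleftrightarrow> h - h' \<in> I"
proof
  assume "coset_of I h = coset_of I h'"
  moreover have "h' \<in> coset_of I h'" using subspace_0[OF assms] by (simp add: coset_of_def)
  ultimately have "h' \<in> coset_of I h" by simp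
  thus "h - h' \<in> I" by (simp add: coset_of_def)
next
  assume d: "h - h' \<in> I"
  have "h - y \<in> I \<longleftrightarrow> h' - y \<in> I" for y
  proof
    assume "h - y \<in> I"
    from subspace_diff[OF assms this d] show "h' - y \<in> I" by (simp add: algebra_simps)
  next
    assume "h' - y \<in> I"
    from subspace_add[OF assms d this] show "h - y \<in> I" by (simp add: algebra_simps)
  qed
  thus "coset_of I h = coset_of I h'" by (simp add: coset_of_def)
qed

lemma mem_coset_of_iff:
  assumes "subspace I"
  shows "x \<in> coset_of I h \<longleftrightarrow> coset_of I h = coset_of I x"
  unfolding coset_of_eq_iff[OF assms] by (simp add: coset_of_def)

lemma quotient_by_inject:
  assumes "subspace I" "subspace J" "quotient_by I = quotient_by J"
  shows "I = J"
proof -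
  have *: "coset_of K 0 = K" if "subspace K" for K
    by (auto simp: coset_of_def dest: subspace_neg[OF that])
  from assms(3) obtain h where "coset_of I 0 = coset_of J h" unfolding quotient_by_eq by blast
  moreover have "0 \<in> coset_of I 0" using subspace_0[OF assms(1)] by (simp add: coset_of_def)
  ultimately have "coset_of I 0 = coset_of J 0" using mem_coset_of_iff[OF assms(2), of 0 h] by simp
  thus ?thesis using * assms by simp
qed

lemma quotient_map_eq:
  assumes "subspace I"
  shows "quotient_map (quotient_by I) = coset_of I"
proof
  fix h
  show "quotient_map (quotient_by I) h = coset_of I h"
    unfolding quotient_map_def quotient_by_eq
    by (rule the_equality) (auto simp: mem_coset_of_iff[OF assms])
qed

lemma quotient_space_simps:
  assumes "subspace I"
  shows "carrier (quotient_space scale (quotient_by I)) = range (coset_of I)"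
    and "vadd (quotient_space scale (quotient_by I)) (coset_of I x) (coset_of I y) = coset_of I (x + y)"
    and "vscale (quotient_space scale (quotient_by I)) a (coset_of I x) = coset_of I (scale a x)"
proof -
  show "carrier (quotient_space scale (quotient_by I)) = range (coset_of I)"
    by (simp add: quotient_space_def quotient_by_eq)
  have x: "x \<in> coset_of I x" for x using mem_coset_of_iff[OF assms] by simp
  have add: "x' + y' \<in> coset_of I (x + y)" if "x' \<in> coset_of I x" "y' \<in> coset_of I y" for x' y'
    using subspace_add[OF assms, of "x - x'" "y - y'"] that by (simp add: coset_of_def algebra_simps)
  show "vadd (quotient_space scale (quotient_by I)) (coset_of I x) (coset_of I y) = coset_of I (x + y)"
    unfolding quotient_space_def quotient_by_eq vspace.simps
  proof (rule the_equality)
    fix Z assume Z: "Z \<in> range (coset_of I) \<and> (\<forall>x\<in>coset_of I x. \<forall>y\<in>coset_of I y. x + y \<in> Z)"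
    hence "x + y \<in> Z" using x by blast
    with Z show "Z = coset_of I (x + y)" by (auto simp: mem_coset_of_iff[OF assms])
  qed (auto intro: add)
  have scale: "scale a x' \<in> coset_of I (scale a x)" if "x' \<in> coset_of I x" for x'
    using subspace_scale[OF assms, of "x - x'" a] that by (simp add: coset_of_def scale_right_diff_distrib)
  show "vscale (quotient_space scale (quotient_by I)) a (coset_of I x) = coset_of I (scale a x)"
    unfolding quotient_space_def quotient_by_eq vspace.simps
  proof (rule the_equality)
    fix Z assume Z: "Z \<in> range (coset_of I) \<and> (\<forall>x\<in>coset_of I x. scale a x \<in> Z)"
    hence "scale a x \<in> Z" using x by blast
    with Z show "Z = coset_of I (scale a x)" by (auto simp: mem_coset_of_iff[OF assms])
  qed (auto intro: scale)
qed

text \<open>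
  Linear forms on \<open>H/I\<close> correspond to the linear forms on \<open>H\<close> that annihilate \<open>I\<close>.
\<close>

lemma linear_form_quotient_iff:
  assumes "subspace I"
  shows "linear_form (quotient_space scale (quotient_by I)) f \<longleftrightarrow>
    (\<lambda>x. f (coset_of I x)) \<in> annihilator scale I"
proof -
  have "f (coset_of I u) = 0" if "linear_form (type_space scale) (\<lambda>x. f (coset_of I x))" "u \<in> I" for u
  proof -
    have "coset_of I u = coset_of I 0" using that(2) by (simp add: coset_of_eq_iff[OF assms])
    thus ?thesis using linear_form_0[OF that(1)] by simp
  qed
  hence "linear_form (type_space scale) (\<lambda>x. f (coset_of I x)) \<longleftrightarrow>
      (\<lambda>x. f (coset_of I x)) \<in> annihilator scale I"
    unfolding annihilator_def by blast
  thus ?thesis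
    by (simp add: linear_form_def quotient_space_simps[OF assms])
qed

text \<open>
  The form on the quotient takes the value of \<open>f\<close> at any element of a coset: elements of a coset
  differ by elements of \<open>I\<close>.
\<close>

lemma factor_through_quotient:
  assumes I: "subspace I" and f: "f \<in> annihilator scale I"
  obtains g where "linear_form (quotient_space scale (quotient_by I)) g" "\<And>x. g (coset_of I x) = f x"
proof -
  define g where "g Z = f (SOME z. z \<in> Z)" for Z
  have "g (coset_of I x) = f x" for x
  proof -
    have "x \<in> coset_of I x" using mem_coset_of_iff[OF I] by simp
    hence "(SOME z. z \<in> coset_of I x) \<in> coset_of I x" by (rule someI)
    hence "x - (SOME z. z \<in> coset_of I x) \<in> I"
      by (simp add: coset_of_def)
    hence "f (x - (SOME z. z \<in> coset_of I x)) = 0"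
      using f by (simp add: annihilator_def)
    moreover have "linear_form (type_space scale) f" using f by (simp add: annihilator_def)
    ultimately show ?thesis by (simp add: g_def linear_form_diff[of scale f])
  qed
  with f show ?thesis
    by (intro that[of g]) (simp_all add: linear_form_quotient_iff[OF I])
qed

end

text \<open>
  The equation \<open>(id \<otimes> \<pi>) X = a \<otimes> \<pi> h\<close> in \<open>A \<otimes>\<^sub>v H/I\<close>.  A bilinear form on \<open>A \<times> H/I\<close>, pulled back
  along \<open>id \<times> \<pi>\<close>, annihilates \<open>I\<close> in its second argument, so after expansion over \<open>A\<close> it involves
  only product forms \<open>f \<otimes> k\<close> with \<open>k\<close> annihilating \<open>I\<close>.
\<close>

lemma tensor_map_quotient_eq_pure_iff_forms:
  fixes sA :: "'k::field \<Rightarrow> 'a::ab_group_add \<Rightarrow> 'a" and sH :: "'k \<Rightarrow> 'h::ab_group_add \<Rightarrow> 'h"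
  assumes A: "vector_space sA" and H: "vector_space sH" and I: "module.subspace sH I"
    and X: "X \<in> carrier (type_space sA \<otimes>\<^sub>v type_space sH)"
  defines "Q \<equiv> quotient_by I"
  shows "tensor_map (type_space sA) (quotient_space sH Q) id (quotient_map Q) X
      = pure_tensor (type_space sA) (quotient_space sH Q) a (quotient_map Q h) \<longleftrightarrow>
    (\<forall>f k. linear_form (type_space sA) f \<longrightarrow> k \<in> annihilator sH I \<longrightarrow> tensor_form f k X = f a * k h)"
proof -
  interpret A: vector_space sA by fact
  interpret H: vector_space sH by fact
  let ?A = "type_space sA" and ?H = "type_space sH" and ?Q = "quotient_space sH Q"
  let ?\<pi> = "coset_of I"
  define m where "m = free_ext (\<lambda>(v, w). Poly_Mapping.single (v::'a, ?\<pi> w) (1::'k))"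
  have \<pi>: "quotient_map Q = ?\<pi>" unfolding Q_def by (rule H.quotient_map_eq[OF I])
  have carrier_Q: "carrier ?Q = range ?\<pi>" unfolding Q_def by (rule H.quotient_space_simps[OF I])
  have map_eq: "tensor_map ?A ?Q id (quotient_map Q) X = (\<Union>x\<in>X. tensor_class ?A ?Q (m x))"
    by (simp add: tensor_map_def m_def \<pi>)
  have pure_eq: "pure_tensor ?A ?Q a (quotient_map Q h) = tensor_class ?A ?Q (Poly_Mapping.single (a, ?\<pi> h) 1)"
    by (simp add: pure_tensor_def \<pi>)
  have m_formal: "m x \<in> formal_tensors ?A ?Q" for x
    using keys_free_ext[of "\<lambda>(v, w). Poly_Mapping.single (v, ?\<pi> w) (1::'k)" x]
    by (fastforce simp: m_def formal_tensors_def carrier_Q)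
  have m_form: "free_form \<beta> (m x) = free_form (\<lambda>(v, w). \<beta> (v, ?\<pi> w)) x" for \<beta> x
    by (simp add: m_def free_form_free_ext case_prod_unfold)
  have pure_formal: "Poly_Mapping.single (a, ?\<pi> h) 1 \<in> formal_tensors ?A ?Q"
    by (simp add: formal_tensors_def carrier_Q)
  show ?thesis
    unfolding map_eq pure_eq
  proof (intro iffI allI impI)
    fix f k assume eq: "(\<Union>x\<in>X. tensor_class ?A ?Q (m x)) = tensor_class ?A ?Q (Poly_Mapping.single (a, ?\<pi> h) 1)"
      and f: "linear_form ?A f" and k: "k \<in> annihilator sH I"
    obtain k' where k': "linear_form ?Q k'" "\<And>x. k' (?\<pi> x) = k x"
      unfolding Q_def by (rule H.factor_through_quotient[OF I k]) blast
    obtain x where x: "x \<in> X" using X tensor_carrier_nonempty by metis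
    have "m x \<in> tensor_class ?A ?Q (m x)"
      using m_formal by (simp add: tensor_eq_iff_bilinear_forms)
    hence "(Poly_Mapping.single (a, ?\<pi> h) 1, m x) \<in> tensor_eq ?A ?Q"
      using eq x by blast
    hence "free_form (product_form f k') (m x) = f a * k h"
      using bilinear_product_form[OF f k'(1)] by (auto simp: tensor_eq_iff_bilinear_forms k')
    moreover have "linear_form ?H k" using k by (simp add: annihilator_def)
    ultimately show "tensor_form f k X = f a * k h"
      using tensor_form_eq[OF f, of ?H k, OF _ X x] by (simp add: m_form k' product_form_def[abs_def] case_prod_unfold)
  next
    assume *: "\<forall>f k. linear_form ?A f \<longrightarrow> k \<in> annihilator sH I \<longrightarrow> tensor_form f k X = f a * k h"
    have "(m x, Poly_Mapping.single (a, ?\<pi> h) 1) \<in> tensor_eq ?A ?Q" if x: "x \<in> X" for x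
      unfolding tensor_eq_iff_bilinear_forms
    proof (intro conjI allI impI m_formal pure_formal)
      fix \<beta> assume \<beta>: "bilinear_form ?A ?Q \<beta>"
      let ?\<beta> = "\<lambda>(v, w). \<beta> (v, ?\<pi> w)"
      have ann: "(\<lambda>w. \<beta> (v, ?\<pi> w)) \<in> annihilator sH I" for v
        using \<beta> by (simp add: bilinear_form_def Q_def H.linear_form_quotient_iff[OF I])
      have bil: "bilinear_form ?A ?H ?\<beta>"
        using \<beta> ann by (simp add: bilinear_form_def carrier_Q annihilator_def)
      obtain c where c: "\<And>b. linear_form ?A (\<lambda>v. c v b)" "\<And>v. finite {b. c v b \<noteq> 0}"
          "\<And>v. (\<Sum>b | c v b \<noteq> 0. sA (c v b) b) = v"
        by (rule A.obtain_adapted_coordinates[OF A.subspace_UNIV]) blast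
      have "free_form ?\<beta> (x - Poly_Mapping.single (a, h) 1) = 0"
      proof (rule zero_if_product_forms_zero[OF c(2,3) bil])
        fix b
        have "tensor_form (\<lambda>v. c v b) (\<lambda>w. \<beta> (b, ?\<pi> w)) X = c a b * \<beta> (b, ?\<pi> h)"
          using * c(1) ann by blast
        moreover have lin: "linear_form ?H (\<lambda>w. \<beta> (b, ?\<pi> w))"
          using ann by (simp add: annihilator_def)
        ultimately show "free_form (\<lambda>(v, w). c v b * ?\<beta> (b, w)) (x - Poly_Mapping.single (a, h) 1) = 0"
          using tensor_form_eq[OF c(1) lin X x] by (simp add: product_form_def[abs_def] case_prod_unfold)
      qed simp
      thus "free_form \<beta> (m x) = free_form \<beta> (Poly_Mapping.single (a, ?\<pi> h) 1)"
        by (simp add: m_form)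
    qed
    hence "tensor_class ?A ?Q (m x) = tensor_class ?A ?Q (Poly_Mapping.single (a, ?\<pi> h) 1)" if "x \<in> X" for x
      using that equiv_class_eq[OF equiv_tensor_eq] by blast
    moreover have "X \<noteq> {}" using X tensor_carrier_nonempty by blast
    ultimately show "(\<Union>x\<in>X. tensor_class ?A ?Q (m x)) = tensor_class ?A ?Q (Poly_Mapping.single (a, ?\<pi> h) 1)"
      by auto
  qed
qed


section \<open>Structure maps evaluated on linear forms\<close>

lemma linear_form_compose:
  assumes "linear_into s T F" "linear_form T f"
  shows "linear_form (type_space s) (\<lambda>v. f (F v))"
  using assms by (simp add: linear_into_def linear_form_def)

text \<open>
  Coassociativity evaluated on \<open>f \<otimes> g \<otimes> k\<close>.  With \<open>f \<cdot> g = (f \<otimes> g) \<circ> \<delta>\<close> and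
  \<open>g * k = (g \<otimes> k) \<circ> \<Delta>\<close> and \<open>X = \<delta> a\<close> it reads \<open>(f \<cdot> g) \<cdot> k = f \<cdot> (g * k)\<close>: this is
  the associativity law of the right action of the dual algebra of \<open>H\<close> on the forms on \<open>A\<close>.
\<close>

lemma coassociativity_forms:
  fixes sA :: "'k::field \<Rightarrow> 'a::ab_group_add \<Rightarrow> 'a" and sH :: "'k \<Rightarrow> 'h::ab_group_add \<Rightarrow> 'h"
  defines "A \<equiv> type_space sA" and "H \<equiv> type_space sH"
  assumes \<delta>: "linear_into sA (A \<otimes>\<^sub>v H) \<delta>" and \<Delta>: "linear_into sH (H \<otimes>\<^sub>v H) \<Delta>"
    and X: "X \<in> carrier (A \<otimes>\<^sub>v H)"
    and coassoc: "tensor_assoc A H H (tensor_map (A \<otimes>\<^sub>v H) H \<delta> id X) = tensor_map A (H \<otimes>\<^sub>v H) id \<Delta> X"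
    and f: "linear_form A f" and g: "linear_form H g" and k: "linear_form H k"
  shows "tensor_form (\<lambda>a. tensor_form f g (\<delta> a)) k X = tensor_form f (\<lambda>h. tensor_form g k (\<Delta> h)) X"
proof -
  note fg = linear_form_tensor_form[OF f g] and gk = linear_form_tensor_form[OF g k]
  note fg_\<delta> = linear_form_compose[OF \<delta> fg] and gk_\<Delta> = linear_form_compose[OF \<Delta> gk]
  have \<delta>_carrier: "\<delta> v \<in> carrier (A \<otimes>\<^sub>v H)" for v using \<delta> by (simp add: linear_into_def)
  have \<Delta>_carrier: "\<Delta> v \<in> carrier (H \<otimes>\<^sub>v H)" for v using \<Delta> by (simp add: linear_into_def)
  obtain x where x: "x \<in> X" using X tensor_carrier_nonempty by metis
  \<comment> \<open>\<open>z\<close> represents the right side of the equation \<open>coassoc\<close>; \<open>y\<close> and \<open>x'\<close> trace it back through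
    the left side to a possibly different representative of \<open>X\<close>.\<close>
  define z where "z = free_ext (\<lambda>(v, w). Poly_Mapping.single (v, \<Delta> w) (1::'k)) x"
  have "z \<in> formal_tensors A (H \<otimes>\<^sub>v H)"
    using keys_free_ext[of "\<lambda>(v, w). Poly_Mapping.single (v, \<Delta> w) (1::'k)" x]
    by (fastforce simp: z_def formal_tensors_def A_def \<Delta>_carrier)
  hence "z \<in> tensor_class A (H \<otimes>\<^sub>v H) z"
    by (simp add: tensor_eq_iff_bilinear_forms)
  hence "z \<in> tensor_map A (H \<otimes>\<^sub>v H) id \<Delta> X"
    using x by (auto simp: tensor_map_def z_def)
  then obtain y where y: "y \<in> tensor_map (A \<otimes>\<^sub>v H) H \<delta> id X"
    and yz: "(free_ext (\<lambda>(X, u). free_ext (\<lambda>(v, w). Poly_Mapping.single (v, pure_tensor H H w u) 1)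
              (SOME x. x \<in> X)) y, z) \<in> tensor_eq A (H \<otimes>\<^sub>v H)"
    unfolding coassoc[symmetric] tensor_assoc_def by blast
  from y obtain x' where x': "x' \<in> X"
    and x'y: "(free_ext (\<lambda>(v, w). Poly_Mapping.single (\<delta> v, w) 1) x', y) \<in> tensor_eq (A \<otimes>\<^sub>v H) H"
    by (auto simp: tensor_map_def)
  have "tensor_form (\<lambda>a. tensor_form f g (\<delta> a)) k X
      = free_form (product_form (\<lambda>a. tensor_form f g (\<delta> a)) k) x'"
    using fg_\<delta> X x' k by (intro tensor_form_eq) (simp_all add: A_def)
  also have "\<dots> = free_form (product_form (tensor_form f g) k)
      (free_ext (\<lambda>(v, w). Poly_Mapping.single (\<delta> v, w) 1) x')"
    by (simp add: free_form_free_ext case_prod_unfold product_form_def[abs_def])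
  also have "\<dots> = free_form (product_form (tensor_form f g) k) y"
    using x'y bilinear_product_form[OF fg k] by (auto simp: tensor_eq_iff_bilinear_forms)
  also have "\<dots> = free_form (product_form f (tensor_form g k))
      (free_ext (\<lambda>(X, u). free_ext (\<lambda>(v, w). Poly_Mapping.single (v, pure_tensor H H w u) 1)
              (SOME x. x \<in> X)) y)"
    unfolding free_form_free_ext
  proof (rule free_form_cong)
    fix p assume "p \<in> Poly_Mapping.keys y"
    have "tensor_form g k (pure_tensor H H w u) = g w * k u" for w u
      using tensor_form_pure[OF g k] by (simp add: H_def)
    hence "free_form (\<lambda>q. f (fst q) * tensor_form g k (pure_tensor H H (snd q) (snd p))) (SOME x. x \<in> fst p)
        = free_form (\<lambda>q. k (snd p) * product_form f g q) (SOME x. x \<in> fst p)"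
      by (simp add: product_form_def mult_ac)
    also have "\<dots> = tensor_form f g (fst p) * k (snd p)"
      by (simp only: free_form_mult_left) (simp add: tensor_form_def)
    finally show "product_form (tensor_form f g) k p = free_form (product_form f (tensor_form g k))
        (case p of (X, u) \<Rightarrow> free_ext (\<lambda>(v, w). Poly_Mapping.single (v, pure_tensor H H w u) 1) (SOME x. x \<in> X))"
      by (simp add: free_form_free_ext case_prod_unfold product_form_def)
  qed
  also have "\<dots> = free_form (product_form f (tensor_form g k)) z"
    using yz bilinear_product_form[OF f gk] by (auto simp: tensor_eq_iff_bilinear_forms)
  also have "\<dots> = free_form (product_form f (\<lambda>h. tensor_form g k (\<Delta> h))) x"
    by (simp add: z_def free_form_free_ext case_prod_unfold product_form_def[abs_def])
  also have "\<dots> = tensor_form f (\<lambda>h. tensor_form g k (\<Delta> h)) X"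
    by (rule tensor_form_eq[symmetric]) (use f gk_\<Delta> X x in \<open>simp_all add: H_def\<close>)
  finally show ?thesis .
qed

text \<open>
  A product of tensors is evaluated by fixing a representative \<open>y\<close> of the right factor; each of its
  terms \<open>v' \<otimes> w'\<close> then acts on the forms by right translation.
\<close>

lemma tensor_form_mult:
  assumes A: "unital_algebra sA" and B: "unital_algebra sB"
    and f: "linear_form (type_space sA) f" and g: "linear_form (type_space sB) g"
    and X: "X \<in> carrier (type_space sA \<otimes>\<^sub>v type_space sB)" and y: "y \<in> Y"
    and XY: "tensor_mult (type_space sA) (type_space sB) X Y \<in> carrier (type_space sA \<otimes>\<^sub>v type_space sB)"
  shows "tensor_form f g (tensor_mult (type_space sA) (type_space sB) X Y) =
    free_form (\<lambda>(v', w'). tensor_form (\<lambda>v. f (v * v')) (\<lambda>w. g (w * w')) X) y"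
proof -
  interpret A: unital_algebra sA by fact
  interpret B: unital_algebra sB by fact
  let ?A = "type_space sA" and ?B = "type_space sB"
  have f': "linear_form ?A (\<lambda>v. f (v * v'))" for v'
    using f by (simp add: linear_form_type_space distrib_right A.scale_mult_left)
  have g': "linear_form ?B (\<lambda>w. g (w * w'))" for w'
    using g by (simp add: linear_form_type_space distrib_right B.scale_mult_left)
  obtain x where x: "x \<in> X" using X tensor_carrier_nonempty by metis
  define z where "z = free_ext (\<lambda>(v, w). free_ext (\<lambda>(v', w'). Poly_Mapping.single (v * v', w * w') 1) y) x"
  have "z \<in> tensor_class ?A ?B z" by (simp add: tensor_eq_iff_bilinear_forms)
  hence "z \<in> tensor_mult ?A ?B X Y" using x y unfolding tensor_mult_def z_def by blast
  hence "tensor_form f g (tensor_mult ?A ?B X Y) = free_form (product_form f g) z"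
    by (rule tensor_form_eq[OF f g XY])
  also have "\<dots> = free_form (\<lambda>p. free_form (\<lambda>q. f (fst p * fst q) * g (snd p * snd q)) y) x"
    by (simp add: z_def free_form_free_ext case_prod_unfold)
  also have "\<dots> = free_form (\<lambda>q. free_form (\<lambda>p. f (fst p * fst q) * g (snd p * snd q)) x) y"
    by (rule free_form_swap)
  also have "\<dots> = free_form (\<lambda>(v', w'). tensor_form (\<lambda>v. f (v * v')) (\<lambda>w. g (w * w')) X) y"
    using tensor_form_eq[OF f' g' X x] by (simp add: case_prod_unfold product_form_def[abs_def])
  finally show ?thesis .
qed

text \<open>
  The lift is the single value of the formal sums over all representatives: by well-definedness of
  product forms those values cannot be told apart by linear forms.
\<close>

lemma tensor_form_counit:
  assumes A: "vector_space sA"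
    and f: "linear_form (type_space sA) f" and e: "linear_form (type_space sH) e"
    and X: "X \<in> carrier (type_space sA \<otimes>\<^sub>v type_space sH)"
    and counit: "tensor_lift sA (\<lambda>x h. sA (e h) x) X = a"
  shows "tensor_form f e X = f a"
proof -
  define L where "L x = (\<Sum>(v, w)\<in>Poly_Mapping.keys x. sA (Poly_Mapping.lookup x (v, w)) (sA (e w) v))" for x
  have L: "f' (L x) = tensor_form f' e X" if "linear_form (type_space sA) f'" "x \<in> X" for f' x
    by (simp add: L_def case_prod_unfold linear_form_sum[OF that(1)] linear_form_scale[OF that(1)]
      tensor_form_eq[OF that(1) e X that(2)] free_form_def product_form_def mult_ac)
  obtain x where x: "x \<in> X" using X tensor_carrier_nonempty by metis
  have "L y = L x" if "y \<in> X" for y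
  proof (rule vector_space.eq_if_forms_eq[OF A])
    fix f' assume "linear_form (type_space sA) f'"
    from L[OF this that] L[OF this x] show "f' (L y) = f' (L x)" by simp
  qed
  hence "L ` X = {L x}" using x by blast
  moreover have "tensor_lift sA (\<lambda>x h. sA (e h) x) X = the_elem (L ` X)"
    by (simp add: tensor_lift_def L_def)
  ultimately have "L x = a" using counit by simp
  thus ?thesis using L[OF f x] by simp
qed

text \<open>The map \<open>f \<otimes> id\<close> from \<open>A \<otimes>\<^sub>v H\<close> to \<open>H\<close>.\<close>

definition slice :: "('k::field \<Rightarrow> 'h \<Rightarrow> 'h) \<Rightarrow> ('a \<Rightarrow> 'k) \<Rightarrow> (('a \<times> 'h) \<Rightarrow>\<^sub>0 'k) set \<Rightarrow> 'h::ab_group_add" where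
  "slice s f X = (let x = SOME x. x \<in> X in
     \<Sum>p\<in>Poly_Mapping.keys x. s (Poly_Mapping.lookup x p * f (fst p)) (snd p))"

lemma form_slice:
  assumes "linear_form (type_space s) k"
  shows "k (slice s f X) = tensor_form f k X"
  by (simp add: slice_def Let_def linear_form_sum[OF assms] linear_form_scale[OF assms]
    tensor_form_def free_form_def product_form_def mult.assoc)


section \<open>Coinvariants and coideal right ideals\<close>

context right_comodule_algebra
begin

abbreviation "AH \<equiv> type_space scaleA \<otimes>\<^sub>v type_space scaleH"
abbreviation "HH \<equiv> type_space scaleH \<otimes>\<^sub>v type_space scaleH"
abbreviation "linA f \<equiv> linear_form (type_space scaleA) f"
abbreviation "linH f \<equiv> linear_form (type_space scaleH) f"

lemma coaction_linear: "linear_into scaleA AH \<delta>"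
  using coaction_algebra_map by (simp add: algebra_map_into_tensor_def)

lemma coaction_carrier: "\<delta> a \<in> carrier AH"
  using coaction_linear by (simp add: linear_into_def)

lemma comult_carrier: "\<Delta> h \<in> carrier HH"
  using H.comult_linear by (simp add: linear_into_def)

lemma linear_form_coaction: "linA f \<Longrightarrow> linH k \<Longrightarrow> linA (\<lambda>a. tensor_form f k (\<delta> a))"
  by (intro linear_form_compose[OF coaction_linear] linear_form_tensor_form)

lemma linear_form_comult: "linH f \<Longrightarrow> linH k \<Longrightarrow> linH (\<lambda>h. tensor_form f k (\<Delta> h))"
  by (intro linear_form_compose[OF H.comult_linear] linear_form_tensor_form)

lemma linear_form_counit: "linH \<epsilon>"
  using H.counit_linear module_hom.add module_hom.scale
  by (fastforce simp: linear_form_type_space Vector_Spaces.linear_def)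

lemma coaction_one: "linA f \<Longrightarrow> linH k \<Longrightarrow> tensor_form f k (\<delta> 1) = f 1 * k 1"
  using coaction_algebra_map by (simp add: algebra_map_into_tensor_def tensor_form_pure)

lemma comult_one: "linH f \<Longrightarrow> linH k \<Longrightarrow> tensor_form f k (\<Delta> 1) = f 1 * k 1"
  using H.comult_algebra_map by (simp add: algebra_map_into_tensor_def tensor_form_pure)

lemma coaction_mult:
  assumes "linA f" "linH k" "y \<in> \<delta> b"
  shows "tensor_form f k (\<delta> (a * b)) =
    free_form (\<lambda>(b', h). tensor_form (\<lambda>a. f (a * b')) (\<lambda>x. k (x * h)) (\<delta> a)) y"
proof -
  have "\<delta> (a * b) = tensor_mult (type_space scaleA) (type_space scaleH) (\<delta> a) (\<delta> b)"
    using coaction_algebra_map by (simp add: algebra_map_into_tensor_def)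
  thus ?thesis
    using tensor_form_mult[OF A.unital_algebra_axioms H.unital_algebra_axioms assms(1,2) coaction_carrier assms(3)]
      coaction_carrier[of "a * b"] by simp
qed

lemma comult_mult:
  assumes "linH f" "linH k" "y \<in> \<Delta> b"
  shows "tensor_form f k (\<Delta> (a * b)) =
    free_form (\<lambda>(x', h). tensor_form (\<lambda>x. f (x * x')) (\<lambda>x. k (x * h)) (\<Delta> a)) y"
proof -
  have "\<Delta> (a * b) = tensor_mult (type_space scaleH) (type_space scaleH) (\<Delta> a) (\<Delta> b)"
    using H.comult_algebra_map by (simp add: algebra_map_into_tensor_def)
  thus ?thesis
    using tensor_form_mult[OF H.unital_algebra_axioms H.unital_algebra_axioms assms(1,2) comult_carrier assms(3)]
      comult_carrier[of "a * b"] by simp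
qed

lemma linear_form_mult_right: "linH k \<Longrightarrow> linH (\<lambda>x. k (x * h))"
  by (simp add: linear_form_type_space distrib_right H.scale_mult_left)

lemma linear_form_mult_rightA: "linA k \<Longrightarrow> linA (\<lambda>x. k (x * h))"
  by (simp add: linear_form_type_space distrib_right A.scale_mult_left)

lemma linear_form_mult_leftA: "linA k \<Longrightarrow> linA (\<lambda>x. k (h * x))"
  by (simp add: linear_form_type_space distrib_left A.scale_mult_right)

text \<open>
  Annihilators of a right ideal are stable under right translation.  In this form the right ideal
  property combines with the multiplicativity of \<open>\<delta>\<close> and \<open>\<Delta>\<close>.
\<close>

lemma right_ideal_annihilator_mult:
  assumes "right_ideal scaleH I" "k \<in> annihilator scaleH I"
  shows "(\<lambda>x. k (x * h)) \<in> annihilator scaleH I"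
  using assms linear_form_mult_right by (simp add: right_ideal_def annihilator_def)

lemma mem_coinvariants_iff:
  assumes "H.subspace I"
  shows "a \<in> coinvariants scaleH scaleA \<delta> (quotient_by I) \<longleftrightarrow>
    (\<forall>f k. linA f \<longrightarrow> k \<in> annihilator scaleH I \<longrightarrow> tensor_form f k (\<delta> a) = f a * k 1)"
  unfolding coinvariants_def mem_Collect_eq
  by (rule tensor_map_quotient_eq_pure_iff_forms[OF A.vector_space_axioms H.vector_space_axioms
        assms coaction_carrier])

lemma coinvariants_H_subset:
  assumes "H.subspace I"
  shows "coinvariants_H scaleH scaleA \<delta> \<subseteq> coinvariants scaleH scaleA \<delta> (quotient_by I)"
  unfolding coinvariants_H_def subset_iff mem_coinvariants_iff[OF assms]
  by (simp add: annihilator_def tensor_form_pure)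

text \<open>
  For products, \<open>(f \<otimes> k) (\<delta> a \<delta> b)\<close> is a sum over the terms \<open>b' \<otimes> h\<close> of \<open>\<delta> b\<close>.  Right translation
  of \<open>k\<close> by \<open>h\<close> still annihilates \<open>I\<close>, so coinvariance of \<open>a\<close> applies to each term and replaces
  \<open>\<delta> a\<close> by \<open>a \<otimes> 1\<close>; what remains is the coinvariance of \<open>b\<close>.
\<close>

lemma coinvariants_subalgebra:
  assumes "right_ideal scaleH I"
  shows "is_subalgebra scaleA (coinvariants scaleH scaleA \<delta> (quotient_by I))"
proof -
  have I: "H.subspace I" using assms by (simp add: right_ideal_def)
  let ?B = "coinvariants scaleH scaleA \<delta> (quotient_by I)"
  note mem = mem_coinvariants_iff[OF I]
  have ann: "linH k" if "k \<in> annihilator scaleH I" for k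
    using that by (simp add: annihilator_def)
  have lin: "linA (\<lambda>a. tensor_form f k (\<delta> a) - f a * k 1)"
    if "linA f" "k \<in> annihilator scaleH I" for f k
    using linear_form_coaction[OF that(1) ann[OF that(2)]] that(1)
    by (simp add: linear_form_type_space algebra_simps)
  have mem': "a \<in> ?B \<longleftrightarrow> (\<forall>f k. linA f \<longrightarrow> k \<in> annihilator scaleH I \<longrightarrow>
      tensor_form f k (\<delta> a) - f a * k 1 = 0)" for a
    by (simp add: mem)
  have "A.subspace ?B"
  proof (rule A.subspaceI)
    show "0 \<in> ?B" unfolding mem' using linear_form_0[OF lin] by simp
  next
    fix x y assume "x \<in> ?B" "y \<in> ?B"
    thus "x + y \<in> ?B" unfolding mem' using linear_form_add[OF lin] by simp
  next
    fix c x assume "x \<in> ?B"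
    thus "scaleA c x \<in> ?B" unfolding mem' using linear_form_scale[OF lin] by simp
  qed
  moreover have "1 \<in> ?B" unfolding mem using coaction_one ann by blast
  moreover have "a * b \<in> ?B" if a: "a \<in> ?B" and b: "b \<in> ?B" for a b
    unfolding mem
  proof (intro allI impI)
    fix f k assume f: "linA f" and k: "k \<in> annihilator scaleH I"
    obtain y where y: "y \<in> \<delta> b" using coaction_carrier tensor_carrier_nonempty by metis
    have "tensor_form f k (\<delta> (a * b)) =
        free_form (\<lambda>(b', h). tensor_form (\<lambda>a. f (a * b')) (\<lambda>x. k (x * h)) (\<delta> a)) y"
      by (rule coaction_mult[OF f ann[OF k] y])
    also have "\<dots> = free_form (product_form (\<lambda>b. f (a * b)) k) y"
    proof (rule free_form_cong)
      fix p
      have "tensor_form (\<lambda>a. f (a * fst p)) (\<lambda>x. k (x * snd p)) (\<delta> a) = f (a * fst p) * k (1 * snd p)"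
        using a linear_form_mult_rightA[OF f] right_ideal_annihilator_mult[OF assms k]
        unfolding mem by blast
      thus "(case p of (b', h) \<Rightarrow> tensor_form (\<lambda>a. f (a * b')) (\<lambda>x. k (x * h)) (\<delta> a))
          = product_form (\<lambda>b. f (a * b)) k p"
        by (simp add: case_prod_unfold product_form_def)
    qed
    also have "\<dots> = tensor_form (\<lambda>b. f (a * b)) k (\<delta> b)"
      by (rule tensor_form_eq[symmetric, OF linear_form_mult_leftA[OF f] ann[OF k] coaction_carrier y])
    also have "\<dots> = f (a * b) * k 1"
      using b linear_form_mult_leftA[OF f] k unfolding mem by blast
    finally show "tensor_form f k (\<delta> (a * b)) = f (a * b) * k 1" .
  qed
  ultimately show ?thesis by (simp add: is_subalgebra_def)
qed

text \<open>
  The elements of \<open>H\<close> that must become zero in \<open>H/I\<close> for all elements of \<open>B\<close> to be coinvariant.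
\<close>

definition coinvariance_defects :: "'a set \<Rightarrow> 'h set" where
  "coinvariance_defects B = {slice scaleH f (\<delta> b) - scaleH (f b) 1 | f b. linA f \<and> b \<in> B}"

definition coideal_of :: "'a set \<Rightarrow> 'h set" where
  "coideal_of B = H.span {v * h | v h. v \<in> coinvariance_defects B}"

lemma annihilates_defects_iff:
  assumes "linH k"
  shows "(\<forall>v\<in>coinvariance_defects B. k v = 0) \<longleftrightarrow>
    (\<forall>f. linA f \<longrightarrow> (\<forall>b\<in>B. tensor_form f k (\<delta> b) = f b * k 1))"
proof -
  have "k (slice scaleH f (\<delta> b) - scaleH (f b) 1) = tensor_form f k (\<delta> b) - f b * k 1" for f b
    by (simp add: linear_form_diff[OF assms] linear_form_scale[OF assms] form_slice[OF assms])
  moreover have "(\<forall>v\<in>coinvariance_defects B. k v = 0) \<longleftrightarrow>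
      (\<forall>f b. linA f \<longrightarrow> b \<in> B \<longrightarrow> k (slice scaleH f (\<delta> b) - scaleH (f b) 1) = 0)"
    unfolding coinvariance_defects_def by blast
  ultimately show ?thesis by auto
qed

lemma coideal_of_is_right_ideal: "right_ideal scaleH (coideal_of B)"
  unfolding right_ideal_def
proof (intro conjI ballI allI)
  show "H.subspace (coideal_of B)" by (simp add: coideal_of_def)
next
  fix x h assume "x \<in> coideal_of B"
  thus "x * h \<in> coideal_of B"
    unfolding coideal_of_def
  proof (induction rule: H.span_induct_alt)
    case base
    show ?case by (simp add: H.span_zero)
  next
    case (step c x y)
    then obtain v h' where v: "v \<in> coinvariance_defects B" "x = v * h'" by blast
    hence "x * h = v * (h' * h)" by (simp add: mult.assoc)
    hence "x * h \<in> H.span {v * h | v h. v \<in> coinvariance_defects B}"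
      using v(1) by (blast intro: H.span_base)
    with step show ?case
      by (simp add: distrib_right H.scale_mult_left H.span_add H.span_scale)
  qed
qed

lemma defects_subset_coideal_of: "coinvariance_defects B \<subseteq> coideal_of B"
proof
  fix v assume "v \<in> coinvariance_defects B"
  hence "v * 1 \<in> coideal_of B" unfolding coideal_of_def by (blast intro: H.span_base)
  thus "v \<in> coideal_of B" by simp
qed

text \<open>
  The comultiplication half of the statement that the defects span a coideal.  Coassociativity of
  \<open>\<delta>\<close> moves \<open>\<Delta>\<close> over to a second application of \<open>\<delta>\<close>, where the conditions on \<open>k\<close> and then on
  \<open>g\<close> apply.
\<close>

lemma comult_defect:
  assumes g: "linH g" "\<forall>v\<in>coinvariance_defects B. g v = 0"
    and k: "linH k" "\<forall>v\<in>coinvariance_defects B. k v = 0"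
    and v: "v \<in> coinvariance_defects B"
  shows "tensor_form g k (\<Delta> v) = 0"
proof -
  obtain f b where f: "linA f" and b: "b \<in> B" and v_eq: "v = slice scaleH f (\<delta> b) - scaleH (f b) 1"
    using v by (auto simp: coinvariance_defects_def)
  let ?gk = "\<lambda>h. tensor_form g k (\<Delta> h)" and ?fg = "\<lambda>a. tensor_form f g (\<delta> a)"
  have gk: "linH ?gk" by (rule linear_form_comult[OF g(1) k(1)])
  have fg: "linA ?fg" by (rule linear_form_coaction[OF f g(1)])
  have "?gk v = ?gk (slice scaleH f (\<delta> b)) - f b * ?gk 1"
    unfolding v_eq by (simp only: linear_form_diff[OF gk] linear_form_scale[OF gk])
  also have "?gk (slice scaleH f (\<delta> b)) = tensor_form f ?gk (\<delta> b)"
    by (rule form_slice[OF gk])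
  also have "\<dots> = tensor_form ?fg k (\<delta> b)"
    by (rule coassociativity_forms[symmetric, OF coaction_linear H.comult_linear coaction_carrier
          coaction_coassoc f g(1) k(1)])
  also have "\<dots> = ?fg b * k 1"
    using k fg b by (simp add: annihilates_defects_iff)
  also have "?fg b = f b * g 1"
    using g f b by (simp add: annihilates_defects_iff)
  also have "?gk 1 = g 1 * k 1"
    by (rule comult_one[OF g(1) k(1)])
  finally show ?thesis by simp
qed

text \<open>
  Counitality of \<open>\<delta>\<close> says that \<open>(f \<otimes> \<epsilon>) (\<delta> b) = f b\<close>, which is \<open>f b * \<epsilon> 1\<close>.
\<close>

lemma counit_defect:
  assumes "v \<in> coinvariance_defects B"
  shows "\<epsilon> v = 0"
proof -
  have "tensor_form f \<epsilon> (\<delta> b) = f b * \<epsilon> 1" if "linA f" for f b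
    using tensor_form_counit[OF A.vector_space_axioms that linear_form_counit coaction_carrier coaction_counit]
    by (simp add: H.counit_one)
  hence "\<forall>v\<in>coinvariance_defects B. \<epsilon> v = 0"
    by (simp add: annihilates_defects_iff[OF linear_form_counit])
  thus ?thesis using assms by blast
qed

text \<open>
  By multiplicativity of \<open>\<Delta>\<close>, \<open>(g \<otimes> k) (\<Delta> (v h))\<close> is a combination of values
  \<open>(g' \<otimes> k') (\<Delta> v)\<close> with \<open>g'\<close>, \<open>k'\<close> right translates of \<open>g\<close>, \<open>k\<close>.  These still annihilate the
  right ideal, hence the defects, so the values vanish.
\<close>

lemma coideal_of_is_coideal: "coideal scaleH \<Delta> \<epsilon> (coideal_of B)"
  unfolding coideal_iff_forms[OF H.vector_space_axioms H.comult_linear]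
proof (intro conjI ballI)
  show "H.subspace (coideal_of B)" by (simp add: coideal_of_def)
next
  fix x assume "x \<in> coideal_of B"
  thus "\<epsilon> x = 0"
    unfolding coideal_of_def
    by (rule H.linear_form_zero_on_span[OF linear_form_counit, rotated])
      (auto simp: H.counit_mult counit_defect)
next
  fix x g k assume x: "x \<in> coideal_of B"
    and g: "g \<in> annihilator scaleH (coideal_of B)" and k: "k \<in> annihilator scaleH (coideal_of B)"
  have lin: "linH g" "linH k" using g k by (simp_all add: annihilator_def)
  have zero: "linH (\<lambda>x. g (x * h)) \<and> (\<forall>v\<in>coinvariance_defects B. g (v * h) = 0)"
    if "g \<in> annihilator scaleH (coideal_of B)" for g h
    using right_ideal_annihilator_mult[OF coideal_of_is_right_ideal that, of h] defects_subset_coideal_of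
    by (auto simp: annihilator_def)
  show "tensor_form g k (\<Delta> x) = 0"
  proof (rule H.linear_form_zero_on_span[OF linear_form_comult[OF lin] _ x[unfolded coideal_of_def]])
    fix x assume "x \<in> {v * h | v h. v \<in> coinvariance_defects B}"
    then obtain v h where v: "v \<in> coinvariance_defects B" "x = v * h" by blast
    obtain y where y: "y \<in> \<Delta> h" using comult_carrier tensor_carrier_nonempty by metis
    have "tensor_form (\<lambda>x. g (x * p)) (\<lambda>x. k (x * q)) (\<Delta> v) = 0" for p q
      using comult_defect[of "\<lambda>x. g (x * p)" B "\<lambda>x. k (x * q)" v] zero[OF g, of p] zero[OF k, of q] v(1)
      by blast
    thus "tensor_form g k (\<Delta> x) = 0"
      unfolding v(2) comult_mult[OF lin y] by (simp add: free_form_def)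
  qed
qed

text \<open>
  As \<open>J\<close> is a right ideal, it contains \<open>coideal_of B\<close> iff it contains the defects; and it contains them
  iff all its annihilators vanish on them, which is the equation defining coinvariants on forms.
\<close>

lemma coideal_of_subset_iff:
  assumes "right_ideal scaleH J"
  shows "coideal_of B \<subseteq> J \<longleftrightarrow> B \<subseteq> coinvariants scaleH scaleA \<delta> (quotient_by J)"
proof -
  have J: "H.subspace J" using assms by (simp add: right_ideal_def)
  have "coideal_of B \<subseteq> J \<longleftrightarrow> coinvariance_defects B \<subseteq> J"
  proof
    assume "coinvariance_defects B \<subseteq> J"
    hence "v * h \<in> J" if "v \<in> coinvariance_defects B" for v h
      using assms that unfolding right_ideal_def by blast
    hence "{v * h | v h. v \<in> coinvariance_defects B} \<subseteq> J" by blast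
    thus "coideal_of B \<subseteq> J" unfolding coideal_of_def by (rule H.span_minimal[OF _ J])
  qed (rule subset_trans[OF defects_subset_coideal_of])
  also have "\<dots> \<longleftrightarrow> (\<forall>k\<in>annihilator scaleH J. \<forall>v\<in>coinvariance_defects B. k v = 0)"
  proof (intro iffI ballI subsetI)
    fix k v assume "coinvariance_defects B \<subseteq> J" "k \<in> annihilator scaleH J" "v \<in> coinvariance_defects B"
    thus "k v = 0" by (simp add: annihilator_def subset_iff)
  next
    fix v assume zero: "\<forall>k\<in>annihilator scaleH J. \<forall>v\<in>coinvariance_defects B. k v = 0"
      and v: "v \<in> coinvariance_defects B"
    show "v \<in> J"
    proof (rule H.mem_subspace_if_annihilated[OF J])
      fix k assume "linH k" "\<forall>u\<in>J. k u = 0"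
      thus "k v = 0" using zero v by (simp add: annihilator_def)
    qed
  qed
  also have "\<dots> \<longleftrightarrow> (\<forall>k\<in>annihilator scaleH J. \<forall>f. linA f \<longrightarrow>
      (\<forall>b\<in>B. tensor_form f k (\<delta> b) = f b * k 1))"
    by (rule ball_cong[OF refl], rule annihilates_defects_iff) (simp add: annihilator_def)
  also have "\<dots> \<longleftrightarrow> B \<subseteq> coinvariants scaleH scaleA \<delta> (quotient_by J)"
    by (simp only: subset_iff mem_coinvariants_iff[OF J]) metis
  finally show ?thesis .
qed

end


section \<open>The complete lattices\<close>

lemma Quot_gen_carrier:
  "Q \<in> carrier (Quot_gen s \<Delta> \<epsilon>) \<longleftrightarrow> (\<exists>I. Q = quotient_by I \<and> coideal s \<Delta> \<epsilon> I \<and> right_ideal s I)"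
  by (auto simp: Quot_gen_def)

text \<open>
  A quotient determines its ideal, so the order does not depend on a choice of ideals.
\<close>

lemma Quot_gen_le_iff:
  assumes "vector_space s" "coideal s \<Delta> \<epsilon> I" "right_ideal s I" "coideal s \<Delta> \<epsilon> J" "right_ideal s J"
  shows "quotient_by J \<sqsubseteq>\<^bsub>Quot_gen s \<Delta> \<epsilon>\<^esub> quotient_by I \<longleftrightarrow> I \<subseteq> J"
proof -
  have "I' = J'" if "right_ideal s I'" "right_ideal s J'" "quotient_by I' = quotient_by J'" for I' J'
    using that vector_space.quotient_by_inject[OF assms(1)] by (simp add: right_ideal_def)
  thus ?thesis using assms(2-) unfolding Quot_gen_def gorder.simps by blast
qed

lemma coideal_right_ideal_zero:
  assumes "vector_space s" "linear_into s (type_space s \<otimes>\<^sub>v type_space s) \<Delta>"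
    "linear_form (type_space s) \<epsilon>"
  shows "coideal s \<Delta> \<epsilon> {0} \<and> right_ideal s {0}"
proof -
  interpret vector_space s by fact
  have "tensor_form f g (\<Delta> 0) = 0" if "linear_form (type_space s) f" "linear_form (type_space s) g" for f g
    using linear_form_0[OF linear_form_compose[OF assms(2) linear_form_tensor_form[OF that]]] .
  thus ?thesis
    using linear_form_0[OF assms(3)]
    by (simp add: coideal_iff_forms[OF assms(1,2)] right_ideal_def annihilator_def)
qed

text \<open>
  Forms that annihilate the sum annihilate each member of the family, so the coideal condition is
  inherited from the members.
\<close>

lemma coideal_right_ideal_span_Union:
  assumes alg: "unital_algebra s" and \<Delta>: "linear_into s (type_space s \<otimes>\<^sub>v type_space s) \<Delta>"
    and \<epsilon>: "linear_form (type_space s) \<epsilon>"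
    and \<J>: "\<And>I. I \<in> \<J> \<Longrightarrow> coideal s \<Delta> \<epsilon> I \<and> right_ideal s I"
  shows "coideal s \<Delta> \<epsilon> (module.span s (\<Union>\<J>)) \<and> right_ideal s (module.span s (\<Union>\<J>))"
proof -
  interpret unital_algebra s by fact
  let ?S = "span (\<Union>\<J>)"
  note coideal_iff = coideal_iff_forms[OF vector_space_axioms \<Delta>]
  have "\<epsilon> x = 0" if "x \<in> ?S" for x
    by (rule linear_form_zero_on_span[OF \<epsilon> _ that]) (use \<J> in \<open>auto simp: coideal_def\<close>)
  moreover have "tensor_form f g (\<Delta> x) = 0"
    if f: "f \<in> annihilator s ?S" and g: "g \<in> annihilator s ?S" and x: "x \<in> ?S" for f g x
  proof (rule linear_form_zero_on_span[OF _ _ x])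
    show "linear_form (type_space s) (\<lambda>x. tensor_form f g (\<Delta> x))"
      using f g by (intro linear_form_compose[OF \<Delta>] linear_form_tensor_form) (simp_all add: annihilator_def)
    fix x assume "x \<in> \<Union>\<J>"
    then obtain I where I: "I \<in> \<J>" "x \<in> I" by blast
    hence "I \<subseteq> ?S" by (auto intro: span_base)
    hence "f \<in> annihilator s I" "g \<in> annihilator s I"
      using f g annihilator_antimono by blast+
    thus "tensor_form f g (\<Delta> x) = 0" using \<J>[OF I(1)] I(2) by (simp add: coideal_iff)
  qed
  moreover have "x * h \<in> ?S" if "x \<in> ?S" for x h
    using that
  proof (induction rule: span_induct_alt)
    case base
    show ?case by (simp add: span_zero)
  next
    case (step c x y)
    from step(1) obtain I where "I \<in> \<J>" "x \<in> I" by blast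
    hence "x * h \<in> \<Union>\<J>" using \<J> by (auto simp: right_ideal_def)
    with step show ?case
      by (simp add: distrib_right scale_mult_left span_add span_scale span_base)
  qed
  ultimately show ?thesis by (simp add: coideal_iff right_ideal_def)
qed

text \<open>
  Since \<open>H/J \<preceq> H/I\<close> means \<open>I \<subseteq> J\<close>, the top element is \<open>H/0\<close> and the infimum of
  a family is the quotient by the sum of the ideals.
\<close>

lemma complete_lattice_Quot_gen:
  assumes alg: "unital_algebra s" and \<Delta>: "linear_into s (type_space s \<otimes>\<^sub>v type_space s) \<Delta>"
    and \<epsilon>: "linear_form (type_space s) \<epsilon>"
  shows "complete_lattice (Quot_gen s \<Delta> \<epsilon>)"
proof -
  interpret unital_algebra s by fact
  let ?L = "Quot_gen s \<Delta> \<epsilon>"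
  let ?P = "\<lambda>I. coideal s \<Delta> \<epsilon> I \<and> right_ideal s I"
  have le: "quotient_by J \<sqsubseteq>\<^bsub>?L\<^esub> quotient_by I \<longleftrightarrow> I \<subseteq> J" if "?P I" "?P J" for I J
    using that Quot_gen_le_iff[OF vector_space_axioms] by blast
  have eq: "x .=\<^bsub>?L\<^esub> y \<longleftrightarrow> x = y" for x y by (simp add: Quot_gen_def)
  interpret L: partial_order ?L
  proof
    fix x y z assume "x \<in> carrier ?L" "y \<in> carrier ?L" "z \<in> carrier ?L"
    then obtain I J K where IJK: "x = quotient_by I" "?P I" "y = quotient_by J" "?P J" "z = quotient_by K" "?P K"
      unfolding Quot_gen_carrier by metis
    show "x \<sqsubseteq>\<^bsub>?L\<^esub> z" if "x \<sqsubseteq>\<^bsub>?L\<^esub> y" "y \<sqsubseteq>\<^bsub>?L\<^esub> z"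
      using that IJK le by auto
  next
    fix x y assume "x \<in> carrier ?L" "y \<in> carrier ?L"
    then obtain I J where IJ: "x = quotient_by I" "?P I" "y = quotient_by J" "?P J"
      unfolding Quot_gen_carrier by metis
    show "x .=\<^bsub>?L\<^esub> y" if "x \<sqsubseteq>\<^bsub>?L\<^esub> y" "y \<sqsubseteq>\<^bsub>?L\<^esub> x"
      using that IJ le by (auto simp: eq)
  next
    fix x assume "x \<in> carrier ?L"
    then obtain I where "x = quotient_by I" "?P I" unfolding Quot_gen_carrier by metis
    thus "x \<sqsubseteq>\<^bsub>?L\<^esub> x" using le by simp
  qed (auto simp: eq fun_eq_iff)
  show ?thesis
  proof (rule L.complete_lattice_criterion1)
    have zero: "?P {0}" using coideal_right_ideal_zero[OF vector_space_axioms \<Delta> \<epsilon>] .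
    have "x \<sqsubseteq>\<^bsub>?L\<^esub> quotient_by {0}" if x: "x \<in> carrier ?L" for x
    proof -
      obtain I where I: "x = quotient_by I" "?P I" using x unfolding Quot_gen_carrier by metis
      moreover have "0 \<in> I" using I(2) by (simp add: right_ideal_def subspace_0)
      ultimately show ?thesis using le[OF zero, of I] by simp
    qed
    moreover have "quotient_by {0} \<in> carrier ?L" using zero Quot_gen_carrier by blast
    ultimately show "\<exists>g. greatest ?L g (carrier ?L)" unfolding greatest_def by blast
  next
    fix X assume X: "X \<subseteq> carrier ?L"
    define \<J> where "\<J> = {I. ?P I \<and> quotient_by I \<in> X}"
    have X_eq: "X = quotient_by ` \<J>"
      using X unfolding \<J>_def by (auto simp: Quot_gen_carrier subset_iff)
    have sum: "?P (span (\<Union>\<J>))"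
      by (rule coideal_right_ideal_span_Union[OF alg \<Delta> \<epsilon>]) (simp add: \<J>_def)
    have Lower: "l \<in> Lower ?L X \<longleftrightarrow> (\<exists>J. l = quotient_by J \<and> ?P J \<and> \<Union>\<J> \<subseteq> J)" for l
    proof -
      have "quotient_by J \<in> Lower ?L X \<longleftrightarrow> \<Union>\<J> \<subseteq> J" if "?P J" for J
      proof -
        have "quotient_by J \<in> Lower ?L X \<longleftrightarrow> (\<forall>I\<in>\<J>. quotient_by J \<sqsubseteq>\<^bsub>?L\<^esub> quotient_by I)"
          using X that by (auto simp: Lower_def X_eq Quot_gen_carrier)
        also have "\<dots> \<longleftrightarrow> (\<forall>I\<in>\<J>. I \<subseteq> J)"
          using le[OF _ that] by (simp add: \<J>_def)
        finally show ?thesis by blast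
      qed
      moreover have "l \<in> Lower ?L X \<Longrightarrow> \<exists>J. l = quotient_by J \<and> ?P J"
        by (simp add: Lower_def Quot_gen_carrier)
      ultimately show ?thesis by metis
    qed
    have "l \<sqsubseteq>\<^bsub>?L\<^esub> quotient_by (span (\<Union>\<J>))" if l: "l \<in> Lower ?L X" for l
    proof -
      obtain J where J: "l = quotient_by J" "?P J" "\<Union>\<J> \<subseteq> J" using l unfolding Lower by metis
      moreover have "span (\<Union>\<J>) \<subseteq> J"
        using J by (intro span_minimal) (simp_all add: right_ideal_def)
      ultimately show ?thesis using le[OF sum] by simp
    qed
    moreover have "quotient_by (span (\<Union>\<J>)) \<in> Lower ?L X"
      unfolding Lower using sum span_superset by blast
    ultimately have "greatest ?L (quotient_by (span (\<Union>\<J>))) (Lower ?L X)"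
      unfolding greatest_def by (simp add: Lower_def)
    thus "\<exists>i. greatest ?L i (Lower ?L X)" ..
  qed
qed

lemma complete_lattice_Sub_alg:
  assumes "vector_space s"
  shows "complete_lattice (Sub_alg s C)"
proof -
  interpret vector_space s by fact
  let ?L = "Sub_alg s C"
  have carrier: "B \<in> carrier ?L \<longleftrightarrow> is_subalgebra s B \<and> C \<subseteq> B" for B by (simp add: Sub_alg_def)
  have le: "B \<sqsubseteq>\<^bsub>?L\<^esub> B' \<longleftrightarrow> B \<subseteq> B'" for B B' by (simp add: Sub_alg_def)
  interpret L: partial_order ?L
    by standard (auto simp: Sub_alg_def fun_eq_iff)
  show ?thesis
  proof (rule L.complete_lattice_criterion1)
    have "is_subalgebra s UNIV" by (simp add: is_subalgebra_def)
    thus "\<exists>g. greatest ?L g (carrier ?L)"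
      by (intro exI[of _ UNIV]) (auto simp: greatest_def Sub_alg_def)
  next
    fix X assume X: "X \<subseteq> carrier ?L"
    have "is_subalgebra s (\<Inter>X)"
      using X unfolding is_subalgebra_def
      by (auto simp: subset_iff carrier is_subalgebra_def intro!: subspace_Inter)
    moreover have "C \<subseteq> \<Inter>X" using X carrier by blast
    ultimately have Inter: "\<Inter>X \<in> carrier ?L" by (simp add: carrier)
    have "X \<inter> carrier ?L = X" using X by blast
    hence "Lower ?L X = {l \<in> carrier ?L. \<forall>B\<in>X. l \<subseteq> B}"
      by (auto simp: Lower_def le)
    hence "greatest ?L (\<Inter>X) (Lower ?L X)"
      using Inter by (auto simp: greatest_def le)
    thus "\<exists>i. greatest ?L i (Lower ?L X)" ..
  qed
qed


section \<open>The Galois connection\<close>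

text \<open>
  Units and order reversal both follow from the adjunction, as for adjoint functors between
  posets.
\<close>

lemma antitone_galois_connectionI:
  assumes "partial_order P" "partial_order R"
    and \<phi>: "\<phi> \<in> carrier P \<rightarrow> carrier R" and \<psi>: "\<psi> \<in> carrier R \<rightarrow> carrier P"
    and adj: "\<And>p r. p \<in> carrier P \<Longrightarrow> r \<in> carrier R \<Longrightarrow> p \<sqsubseteq>\<^bsub>P\<^esub> \<psi> r \<longleftrightarrow> r \<sqsubseteq>\<^bsub>R\<^esub> \<phi> p"
  shows "antitone_galois_connection P R \<phi> \<psi>"
proof -
  interpret P: partial_order P by fact
  interpret R: partial_order R by fact
  have \<phi>': "\<phi> p \<in> carrier R" if "p \<in> carrier P" for p using \<phi> that by blast
  have \<psi>': "\<psi> r \<in> carrier P" if "r \<in> carrier R" for r using \<psi> that by blast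
  have unit_P: "p \<sqsubseteq>\<^bsub>P\<^esub> \<psi> (\<phi> p)" if "p \<in> carrier P" for p
    using adj[OF that \<phi>'[OF that]] \<phi>'[OF that] by simp
  have unit_R: "r \<sqsubseteq>\<^bsub>R\<^esub> \<phi> (\<psi> r)" if "r \<in> carrier R" for r
    using adj[OF \<psi>'[OF that] that] \<psi>'[OF that] by simp
  have "\<phi> q \<sqsubseteq>\<^bsub>R\<^esub> \<phi> p" if "p \<in> carrier P" "q \<in> carrier P" "p \<sqsubseteq>\<^bsub>P\<^esub> q" for p q
    using adj[of p "\<phi> q"] P.le_trans[OF that(3) unit_P] that \<phi>' \<psi>' by simp
  moreover have "\<psi> s \<sqsubseteq>\<^bsub>P\<^esub> \<psi> r" if "r \<in> carrier R" "s \<in> carrier R" "r \<sqsubseteq>\<^bsub>R\<^esub> s" for r s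
    using adj[of "\<psi> s" r] R.le_trans[OF that(3) unit_R] that \<phi>' \<psi>' by simp
  ultimately show ?thesis
    using \<phi> \<psi> unit_P unit_R unfolding antitone_galois_connection_def by blast
qed

theorem theorem3p5:
  fixes scaleH :: "'k::field \<Rightarrow> 'h::{ring, monoid_mult} \<Rightarrow> 'h"
    and \<Delta> :: "'h \<Rightarrow> (('h \<times> 'h) \<Rightarrow>\<^sub>0 'k) set"
    and \<epsilon> :: "'h \<Rightarrow> 'k"
    and S :: "'h \<Rightarrow> 'h"
    and scaleA :: "'k \<Rightarrow> 'a::{ring, monoid_mult} \<Rightarrow> 'a"
    and \<delta> :: "'a \<Rightarrow> (('a \<times> 'h) \<Rightarrow>\<^sub>0 'k) set"
  assumes "hopf_algebra scaleH \<Delta> \<epsilon> S"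
    and "right_comodule_algebra scaleH \<Delta> \<epsilon> scaleA \<delta>"
  shows "complete_lattice (Quot_gen scaleH \<Delta> \<epsilon>) \<and>
         complete_lattice (Sub_alg scaleA (coinvariants_H scaleH scaleA \<delta>)) \<and>
         (\<exists>\<phi> \<psi>.
            antitone_galois_connection (Quot_gen scaleH \<Delta> \<epsilon>)
              (Sub_alg scaleA (coinvariants_H scaleH scaleA \<delta>)) \<phi> \<psi> \<and>
            (\<forall>Q\<in>carrier (Quot_gen scaleH \<Delta> \<epsilon>). \<phi> Q = coinvariants scaleH scaleA \<delta> Q))"
proof -
  interpret right_comodule_algebra scaleH \<Delta> \<epsilon> scaleA \<delta> by fact
  let ?P = "Quot_gen scaleH \<Delta> \<epsilon>" and ?R = "Sub_alg scaleA (coinvariants_H scaleH scaleA \<delta>)"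
  let ?\<phi> = "coinvariants scaleH scaleA \<delta>" and ?\<psi> = "\<lambda>B. quotient_by (coideal_of B)"
  have P: "complete_lattice ?P"
    by (rule complete_lattice_Quot_gen[OF H.unital_algebra_axioms H.comult_linear linear_form_counit])
  have R: "complete_lattice ?R"
    by (rule complete_lattice_Sub_alg[OF A.vector_space_axioms])
  have \<psi>: "?\<psi> B \<in> carrier ?P" for B
    using coideal_of_is_coideal coideal_of_is_right_ideal unfolding Quot_gen_carrier by blast
  have "antitone_galois_connection ?P ?R ?\<phi> ?\<psi>"
  proof (rule antitone_galois_connectionI)
    show "partial_order ?P" "partial_order ?R"
      using P R by (simp_all add: complete_lattice_def)
    show "?\<psi> \<in> carrier ?R \<rightarrow> carrier ?P" using \<psi> by blast
    show "?\<phi> \<in> carrier ?P \<rightarrow> carrier ?R"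
    proof
      fix Q assume "Q \<in> carrier ?P"
      then obtain I where I: "Q = quotient_by I" "right_ideal scaleH I" unfolding Quot_gen_carrier by blast
      moreover have "H.subspace I" using I(2) by (simp add: right_ideal_def)
      ultimately show "?\<phi> Q \<in> carrier ?R"
        using coinvariants_subalgebra coinvariants_H_subset by (simp add: Sub_alg_def)
    qed
    fix Q B assume "Q \<in> carrier ?P" "B \<in> carrier ?R"
    then obtain I where I: "Q = quotient_by I" "coideal scaleH \<Delta> \<epsilon> I" "right_ideal scaleH I"
      unfolding Quot_gen_carrier by blast
    have "Q \<sqsubseteq>\<^bsub>?P\<^esub> ?\<psi> B \<longleftrightarrow> coideal_of B \<subseteq> I"
      unfolding I(1)
      by (rule Quot_gen_le_iff[OF H.vector_space_axioms coideal_of_is_coideal coideal_of_is_right_ideal I(2,3)])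
    also have "\<dots> \<longleftrightarrow> B \<subseteq> ?\<phi> Q"
      unfolding I(1) by (rule coideal_of_subset_iff[OF I(3)])
    finally show "Q \<sqsubseteq>\<^bsub>?P\<^esub> ?\<psi> B \<longleftrightarrow> B \<sqsubseteq>\<^bsub>?R\<^esub> ?\<phi> Q"
      by (simp add: Sub_alg_def)
  qed
  with P R show ?thesis by blast
qed

end
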